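(* Let $(\Omega,\mathcal{A},P)$ be a probability space, $(E,\mathcal{E})$ a measurable space, and $(X_n)_{n\ge 1}$ a c.i.d. sequence of $E$-valued random variables on $(\Omega,\mathcal{A},P)$. Let $k\ge 1$ and $f_1,\dots,f_k\in\mathcal{H}$ with $f_1,\dots,f_{k-1}$ bounded. Then $$\frac{1}{n}\sum_{i=0}^{n-1}\prod_{j=1}^{k} f_j(X_{i+j})\;\to\;\prod_{j=1}^{k}V_{f_j}\qquad\text{a.s. and in }L^1 .$$ In particular, $\frac1n\sum_{i=1}^n f(X_i)\to V_f$, a.s. and in $L^1$, whenever $f\in\mathcal{H}$.
   Context: Let $\mathcal{G}^X_0=\{\varnothing,\Omega\}$ and $\mathcal{G}^X_n=\sigma(X_1,\dots,X_n)$ for $n\ge1$. The sequence $(X_n)_{n\ge1}$ is c.i.d. (conditionally identically distributed) if, for all $k>n\ge0$ and all bounded measurable $f:E\to\mathbb{R}$, $E[f(X_k)\mid\mathcal{G}^X_n]=E[f(X_{n+1})\mid\mathcal{G}^X_n]$ a.s. In particular, a c.i.d. sequence is identically distributed. $\mathcal{H}$ is the class of measurable functions $f:E\to\mathbb{R}$ with $E[|f(X_1)|]<\infty$. For $(X_n)_n$ c.i.d. and $f\in\mathcal{H}$, $V_f$ denotes (a version of) the limit of $(f(X_n))_n$ in $\sigma(L^1,L^\infty)$, i.e. the a.s. unique integrable random variable such that $E[f(X_n)Z]\to E[V_fZ]$ for every bounded random variable $Z$ on $(\Omega,\mathcal{A},P)$. This limit always exists; $V_f$ is also the limit, a.s.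 and in $L^1$, of $E[f(X_{n+1})\mid\mathcal{G}^X_n]$. *)

theory Defs
  imports "HOL-Probability.Probability"
begin

text \<open>
  Sequences \<open>X\<close> are indexed by \<open>nat\<close>, but only the terms \<open>X 1, X 2, \<dots>\<close> are ever used;
  \<open>X 0\<close> is arbitrary and unconstrained.
\<close>

definition past :: "'a measure \<Rightarrow> 'b measure \<Rightarrow> (nat \<Rightarrow> 'a \<Rightarrow> 'b) \<Rightarrow> nat \<Rightarrow> 'a measure" where
  "past M E X n = sigma (space M) (\<Union>i\<in>{1..n}. {X i -` A \<inter> space M | A. A \<in> sets E})"

lemma sets_past_0: "sets (past M E X 0) = {{}, space M}"
  by (simp add: past_def sigma_sets_empty_eq)

lemma subalgebra_past:
  assumes "\<And>i. i \<ge> 1 \<Longrightarrow> X i \<in> measurable M E"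
  shows "subalgebra M (past M E X n)"
proof -
  have "(\<Union>i\<in>{1..n}. {X i -` A \<inter> space M | A. A \<in> sets E}) \<subseteq> sets M"
    using assms by (auto intro: measurable_sets)
  then show ?thesis
    unfolding past_def subalgebra_def
    using sets.space_closed[of M]
    by (auto simp: space_measure_of_conv intro: sets.sigma_sets_subset[THEN subsetD])
qed

definition cid :: "'a measure \<Rightarrow> 'b measure \<Rightarrow> (nat \<Rightarrow> 'a \<Rightarrow> 'b) \<Rightarrow> bool" where
  "cid M E X \<longleftrightarrow>
     (\<forall>i\<ge>1. X i \<in> measurable M E) \<and>
     (\<forall>n k. k > n \<longrightarrow>
       (\<forall>f::'b \<Rightarrow> real. f \<in> borel_measurable E \<longrightarrow> bounded (f ` space E) \<longrightarrow>
         (AE \<omega> in M. real_cond_exp M (past M E X n) (\<lambda>\<omega>. f (X k \<omega>)) \<omega>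
                    = real_cond_exp M (past M E X n) (\<lambda>\<omega>. f (X (Suc n) \<omega>)) \<omega>)))"

definition cid_class :: "'a measure \<Rightarrow> 'b measure \<Rightarrow> (nat \<Rightarrow> 'a \<Rightarrow> 'b) \<Rightarrow> ('b \<Rightarrow> real) set" where
  "cid_class M E X = {f \<in> borel_measurable E. integrable M (\<lambda>\<omega>. f (X 1 \<omega>))}"

definition weak_L1_limit :: "'a measure \<Rightarrow> (nat \<Rightarrow> 'a \<Rightarrow> real) \<Rightarrow> ('a \<Rightarrow> real) \<Rightarrow> bool" where
  "weak_L1_limit M Y V \<longleftrightarrow>
     integrable M V \<and>
     (\<forall>Z \<in> borel_measurable M. bounded (Z ` space M) \<longrightarrow>
       (\<lambda>n. \<integral>\<omega>. Y n \<omega> * Z \<omega> \<partial>M) \<longlonglongrightarrow> (\<integral>\<omega>. V \<omega> * Z \<omega> \<partial>M))"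

text \<open>
  A fixed but arbitrary version of \<open>V\<^sub>f\<close>.  For c.i.d. \<open>X\<close> and \<open>f \<in> cid_class M E X\<close> the limit
  exists and is unique almost surely, so nothing depends on the choice.
\<close>

definition cid_limit :: "'a measure \<Rightarrow> (nat \<Rightarrow> 'a \<Rightarrow> 'b) \<Rightarrow> ('b \<Rightarrow> real) \<Rightarrow> 'a \<Rightarrow> real" where
  "cid_limit M X f = (SOME V. weak_L1_limit M (\<lambda>n \<omega>. f (X n \<omega>)) V)"

definition tendsto_AE :: "'a measure \<Rightarrow> (nat \<Rightarrow> 'a \<Rightarrow> real) \<Rightarrow> ('a \<Rightarrow> real) \<Rightarrow> bool" where
  "tendsto_AE M S L \<longleftrightarrow> (AE \<omega> in M. (\<lambda>n. S n \<omega>) \<longlonglongrightarrow> L \<omega>)"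

text \<open>
  Integrability is demanded explicitly because the Bochner integral of a non-integrable
  function is \<open>0\<close>.
\<close>

definition tendsto_L1 :: "'a measure \<Rightarrow> (nat \<Rightarrow> 'a \<Rightarrow> real) \<Rightarrow> ('a \<Rightarrow> real) \<Rightarrow> bool" where
  "tendsto_L1 M S L \<longleftrightarrow>
     (\<forall>n. integrable M (S n)) \<and> integrable M L \<and>
     (\<lambda>n. \<integral>\<omega>. \<bar>S n \<omega> - L \<omega>\<bar> \<partial>M) \<longlonglongrightarrow> 0"

end

theory Submission
  imports Defs
begin

text \<open>
  For \<open>f\<close> in the class \<open>\<H>\<close>, the c.i.d. property makes the predictive means \<open>E[f(X\<^sub>n\<^sub>+\<^sub>1) | \<G>\<^sub>n]\<close> a
  martingale. It converges almost surely: for bounded \<open>f\<close> because its increments are orthogonal with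
  summable variances, and for general \<open>f\<close> by truncation, Doob's maximal inequality controlling
  the tail uniformly in \<open>n\<close>. The limit is \<open>V\<^sub>f\<close>, since \<open>f(X\<^sub>n\<^sub>+\<^sub>1) - E[f(X\<^sub>n\<^sub>+\<^sub>1) | \<G>\<^sub>n]\<close> is orthogonal and
  bounded in \<open>L\<^sup>2\<close>, hence weakly null by Bessel's inequality.

  If \<open>Y\<^sub>i\<close> is bounded and \<open>\<G>\<^sub>i\<^sub>+\<^sub>r\<close>-measurable with averages tending to \<open>L\<close>, then the averages of
  \<open>Y\<^sub>i f(X\<^sub>i\<^sub>+\<^sub>r\<^sub>+\<^sub>1)\<close> tend to \<open>L V\<^sub>f\<close>: replacing \<open>f(X\<^sub>i\<^sub>+\<^sub>r\<^sub>+\<^sub>1)\<close> by its predictive mean costs a sum of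
  martingale differences, which is negligible as in Kolmogorov's strong law for identically
  distributed variables. Taking for \<open>Y\<^sub>i\<close> the product of the first \<open>k - 1\<close> factors gives the theorem by
  induction on \<open>k\<close>; only the last function needs truncation for the convergence in \<open>L\<^sup>1\<close>.
\<close>

section \<open>Numerical sequences\<close>

lemma cesaro_mean:
  fixes s :: "nat \<Rightarrow> real"
  assumes "s \<longlonglongrightarrow> l"
  shows "(\<lambda>n. (\<Sum>i<n. s i) / real n) \<longlonglongrightarrow> l"
proof (rule LIMSEQ_I)
  fix e :: real assume e: "e > 0"
  from LIMSEQ_D[OF assms, of "e/2"] e obtain N where N: "\<And>n. n \<ge> N \<Longrightarrow> \<bar>s n - l\<bar> < e/2" by auto
  \<comment> \<open>\<open>C\<close> collects the deviations before \<open>N\<close>. It stays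
    fixed, so \<open>K\<close> can be chosen to make it less than \<open>(e/2) * n\<close> for all
    later \<open>n\<close>.\<close>
  define C where "C = (\<Sum>i<N. \<bar>s i - l\<bar>)"
  have C0: "C \<ge> 0" unfolding C_def by (rule sum_nonneg) simp
  obtain K :: nat where K: "real K > 2 * C / e" using reals_Archimedean2 by blast
  have bound: "(\<Sum>i<n. \<bar>s i - l\<bar>) \<le> C + (e/2) * real n" for n
  proof (induction n)
    case 0 then show ?case using C0 by simp
  next
    case (Suc n)
    show ?case
    proof (cases "n < N")
      case True
      have "(\<Sum>i<Suc n. \<bar>s i - l\<bar>) \<le> C" unfolding C_def
        by (rule sum_mono2) (use True in auto)
      also have "\<dots> \<le> C + (e/2) * real (Suc n)" using e by simp
      finally show ?thesis .
    next
      case False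
      with N[of n] have "\<bar>s n - l\<bar> \<le> e/2" by simp
      with Suc show ?thesis by (simp add: algebra_simps add_divide_distrib)
    qed
  qed
  show "\<exists>n0. \<forall>n\<ge>n0. norm ((\<Sum>i<n. s i) / real n - l) < e"
  proof (intro exI[of _ "Suc K"] allI impI)
    fix n assume n: "n \<ge> Suc K"
    then have np: "real n > 0" by simp
    have "(\<Sum>i<n. s i) / real n - l = (\<Sum>i<n. s i - l) / real n"
      using np by (simp add: sum_subtractf field_simps)
    also have "\<bar>\<dots>\<bar> \<le> (\<Sum>i<n. \<bar>s i - l\<bar>) / real n"
      using np by (simp add: divide_right_mono)
    also have "\<dots> \<le> (C + (e/2) * real n) / real n" using bound np by (simp add: divide_right_mono)
    also have "\<dots> < e"
    proof -
      have "2 * C / e < real n" using K n by simp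
      then have "2 * C < e * real n" using e by (simp add: field_simps)
      then show ?thesis using np by (simp add: field_simps)
    qed
    finally show "norm ((\<Sum>i<n. s i) / real n - l) < e" by simp
  qed
qed

text \<open>Summation by parts writes the average as a partial sum of the convergent series minus
  the Cesaro mean of these partial sums, and both have the same limit. The weights are
  \<open>Suc i\<close> because indices start at 0.\<close>

lemma kronecker:
  fixes a :: "nat \<Rightarrow> real"
  assumes "summable (\<lambda>i. a i / real (Suc i))"
  shows "(\<lambda>n. (\<Sum>i<n. a i) / real n) \<longlonglongrightarrow> 0"
proof -
  define s where "s n = (\<Sum>i<n. a i / real (Suc i))" for n
  obtain l where l: "s \<longlonglongrightarrow> l" using assms unfolding s_def summable_iff_convergent convergent_def by blast
  have abel: "(\<Sum>i<n. a i) = real n * s n - (\<Sum>i<n. s i)" for n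
  proof (induction n)
    case (Suc n)
    have "s (Suc n) = s n + a n / real (Suc n)" unfolding s_def by simp
    then have "real (Suc n) * s (Suc n) = real (Suc n) * s n + a n"
      by (simp add: field_simps)
    with Suc show ?case by (simp add: algebra_simps)
  qed (simp add: s_def)
  have eq: "(\<Sum>i<n. a i) / real n = s n - (\<Sum>i<n. s i) / real n" if "n > 0" for n
    using that abel[of n] by (simp add: field_simps)
  have "(\<lambda>n. s n - (\<Sum>i<n. s i) / real n) \<longlonglongrightarrow> l - l"
    by (intro tendsto_diff l cesaro_mean)
  then have "(\<lambda>n. s n - (\<Sum>i<n. s i) / real n) \<longlonglongrightarrow> 0" by simp
  then show ?thesis
    by (rule Lim_transform_eventually)
       (use eq in \<open>auto simp: eventually_sequentially intro!: exI[of _ 1]\<close>)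
qed

text \<open>Serves for truncation at level \<open>N\<close>: first the level is fixed so that the
  uniform error \<open>b N\<close> is small, then \<open>n\<close> is taken large for that
  level.\<close>

lemma tendsto_zero_approx:
  fixes u :: "nat \<Rightarrow> real" and a :: "nat \<Rightarrow> nat \<Rightarrow> real"
  assumes a: "\<And>N. a N \<longlonglongrightarrow> 0" and b: "b \<longlonglongrightarrow> 0" and le: "\<And>N n. \<bar>u n\<bar> \<le> a N n + b N"
  shows "u \<longlonglongrightarrow> 0"
proof (rule LIMSEQ_I)
  fix e :: real assume "e > 0"
  then have e2: "e / 2 > 0" by simp
  obtain N where "\<And>M. M \<ge> N \<Longrightarrow> \<bar>b M\<bar> < e / 2" using LIMSEQ_D[OF b e2] by auto
  then have N: "\<bar>b N\<bar> < e / 2" by simp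
  obtain n0 where n0: "\<And>n. n \<ge> n0 \<Longrightarrow> \<bar>a N n\<bar> < e / 2" using LIMSEQ_D[OF a[of N] e2] by auto
  show "\<exists>n0. \<forall>n\<ge>n0. norm (u n - 0) < e"
  proof (intro exI[of _ n0] allI impI)
    fix n assume "n \<ge> n0"
    from n0[OF this] N le[of n N] show "norm (u n - 0) < e" by simp
  qed
qed

text \<open>Only indices with \<open>x \<le> Suc i\<close> contribute, and the tail of the series of
  inverse squares from \<open>x\<close> on is of order \<open>1/x\<close>. With
  \<open>x = |f(X 1)|\<close> this bounds the variances of variables truncated at growing levels by
  a first moment.\<close>

lemma sum_truncated_squares_le:
  fixes x :: real
  assumes x: "x \<ge> 0"
  shows "(\<Sum>i<N. (if x \<le> real (Suc i) then x\<^sup>2 else 0) / (real (Suc i))\<^sup>2) \<le> 2 * x"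
proof -
  \<comment> \<open>The induction carries a sharper bound from which the remaining tail is
    subtracted; it telescopes because \<open>1/m^2 \<le> 2/m - 2/(m+1)\<close> for
    \<open>m \<ge> 1\<close>.\<close>
  have "(\<Sum>i<N. (if x \<le> real (Suc i) then x\<^sup>2 else 0) / (real (Suc i))\<^sup>2)
      \<le> (if x \<le> real N then 2 * x - 2 * x\<^sup>2 / real (Suc N) else 0)"
  proof (induction N)
    case 0 then show ?case using x by auto
  next
    case (Suc N)
    have tele: "1 / (real (Suc N))\<^sup>2 \<le> 2 / real (Suc N) - 2 / real (Suc (Suc N))"
      by (simp add: divide_simps power2_eq_square algebra_simps)
    have tele': "x\<^sup>2 / (real (Suc N))\<^sup>2 \<le> 2 * x\<^sup>2 / real (Suc N) - 2 * x\<^sup>2 / real (Suc (Suc N))"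
      using mult_left_mono[OF tele, of "x\<^sup>2"] by (simp add: algebra_simps)
    consider "x \<le> real N" | "real N < x" "x \<le> real (Suc N)" | "x > real (Suc N)" by linarith
    then show ?case
    proof cases
      case 1 with Suc tele' show ?thesis by simp
    next
      case 2
      have "2 * x\<^sup>2 / real (Suc N) \<le> 2 * x"
        using 2 x by (simp add: divide_simps power2_eq_square mult_left_mono)
      with 2 Suc tele' show ?thesis by simp
    next
      case 3 with Suc show ?thesis by simp
    qed
  qed
  also have "\<dots> \<le> 2 * x" using x by simp
  finally show ?thesis .
qed

text \<open>The sum counts positive integers below \<open>x\<close>. In expectation it bounds the
  sum of tail probabilities by a first moment, as the Borel-Cantelli lemma requires.\<close>

lemma sum_indicator_less_le:
  fixes x :: real
  assumes "x \<ge> 0"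
  shows "(\<Sum>i<N. if real (Suc i) < x then 1 else 0) \<le> x"
proof -
  have "(\<Sum>i<N. if real (Suc i) < x then 1 else 0) \<le> min x (real N)"
  proof (induction N)
    case (Suc N) then show ?case by auto
  qed (use assms in simp)
  then show ?thesis by simp
qed

lemma integrable_mult_of_squares:
  fixes f g :: "'a \<Rightarrow> real"
  assumes [measurable]: "f \<in> borel_measurable M" "g \<in> borel_measurable M"
    and "integrable M (\<lambda>x. (f x)\<^sup>2)" "integrable M (\<lambda>x. (g x)\<^sup>2)"
  shows "integrable M (\<lambda>x. f x * g x)"
proof (rule Bochner_Integration.integrable_bound)
  show "integrable M (\<lambda>x. (f x)\<^sup>2 + (g x)\<^sup>2)" using assms by simp
  have "\<bar>a * b\<bar> \<le> a\<^sup>2 + b\<^sup>2" for a b :: real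
  proof -
    have "0 \<le> (\<bar>a\<bar> - \<bar>b\<bar>)\<^sup>2" by simp
    then have "2 * (\<bar>a\<bar> * \<bar>b\<bar>) \<le> a\<^sup>2 + b\<^sup>2" by (simp add: power2_diff)
    then show ?thesis unfolding abs_mult
      using mult_nonneg_nonneg[of "\<bar>a\<bar>" "\<bar>b\<bar>"] by linarith
  qed
  then show "AE x in M. norm (f x * g x) \<le> norm ((f x)\<^sup>2 + (g x)\<^sup>2)" by auto
qed simp

section \<open>Maximal inequalities and orthogonal series\<close>

context prob_space
begin

section \<open>Almost sure statements from bounds on probabilities\<close>

text \<open>The intersection of all \<open>B m\<close> lies inside events of arbitrarily small
  probability, so it is a null set.\<close>

lemma AE_escapes:
  assumes "\<And>d. d > 0 \<Longrightarrow> \<exists>m. B m \<in> events \<and> prob (B m) \<le> d"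
  shows "AE x in M. \<exists>m. x \<notin> B m"
proof -
  have "\<exists>m. B m \<in> events \<and> prob (B m) \<le> inverse (real (Suc j))" for j
    by (rule assms) simp
  then obtain m where m: "\<And>j. B (m j) \<in> events" "\<And>j. prob (B (m j)) \<le> inverse (real (Suc j))"
    by metis
  define N where "N = (\<Inter>j. B (m j))"
  have N: "N \<in> events" unfolding N_def using m(1) by auto
  have "prob N \<le> inverse (real (Suc j))" for j
    using finite_measure_mono[of N "B (m j)"] m[of j] unfolding N_def by fastforce
  then have "prob N \<le> 0"
    using LIMSEQ_le_const[OF LIMSEQ_inverse_real_of_nat] by blast
  then have "N \<in> null_sets M" using N by (simp add: null_sets_def emeasure_eq_measure measure_le_0_iff)
  then show ?thesis using AE_not_in[of N M] by (auto simp: N_def)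
qed

text \<open>It suffices to treat the thresholds \<open>1/(j+1)\<close>: each gives a null set by
  \<open>AE_escapes\<close>, and countably many null sets may be discarded together.\<close>

lemma AE_uniformly_small:
  fixes T :: "nat \<Rightarrow> nat \<Rightarrow> 'a \<Rightarrow> real"
  assumes [measurable]: "\<And>m i. T m i \<in> borel_measurable M"
    and "\<And>e d. e > 0 \<Longrightarrow> d > 0 \<Longrightarrow> \<exists>m. prob {x \<in> space M. \<exists>i. \<bar>T m i x\<bar> > e} \<le> d"
  shows "AE x in M. \<forall>e>0. \<exists>m. \<forall>i. \<bar>T m i x\<bar> \<le> e"
proof -
  have "AE x in M. \<exists>m. x \<notin> {x \<in> space M. \<exists>i. \<bar>T m i x\<bar> > inverse (real (Suc j))}" for j
  proof (rule AE_escapes)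
    fix d :: real assume "d > 0"
    with assms(2)[of "inverse (real (Suc j))" d]
    show "\<exists>m. {x \<in> space M. \<exists>i. \<bar>T m i x\<bar> > inverse (real (Suc j))} \<in> events \<and>
          prob {x \<in> space M. \<exists>i. \<bar>T m i x\<bar> > inverse (real (Suc j))} \<le> d" by simp
  qed
  then have "AE x in M. \<forall>j. \<exists>m. x \<notin> {x \<in> space M. \<exists>i. \<bar>T m i x\<bar> > inverse (real (Suc j))}"
    by (simp only: AE_all_countable) simp
  with AE_space show ?thesis
  proof (eventually_elim, intro allI impI)
    fix x and e :: real
    assume x: "x \<in> space M"
      and *: "\<forall>j. \<exists>m. x \<notin> {x \<in> space M. \<exists>i. \<bar>T m i x\<bar> > inverse (real (Suc j))}"
      and e: "e > 0"
    obtain j where j: "inverse (real (Suc j)) < e" using reals_Archimedean[OF e] by auto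
    obtain m where "\<forall>i. \<bar>T m i x\<bar> \<le> inverse (real (Suc j))" using * x by (auto simp: not_less)
    with j show "\<exists>m. \<forall>i. \<bar>T m i x\<bar> \<le> e" by (meson less_imp_le order_trans)
  qed
qed

text \<open>The tail bound makes almost every path Cauchy, by comparing two late terms with the
  common reference term \<open>S m\<close>.\<close>

lemma AE_convergent_of_tails:
  fixes S :: "nat \<Rightarrow> 'a \<Rightarrow> real"
  assumes [measurable]: "\<And>n. S n \<in> borel_measurable M"
    and "\<And>e d. e > 0 \<Longrightarrow> d > 0 \<Longrightarrow> \<exists>m. prob {x \<in> space M. \<exists>i. \<bar>S (m + i) x - S m x\<bar> > e} \<le> d"
  shows "AE x in M. convergent (\<lambda>n. S n x)"
proof -
  have "AE x in M. \<forall>e>0. \<exists>m. \<forall>i. \<bar>S (m + i) x - S m x\<bar> \<le> e"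
    by (rule AE_uniformly_small) (use assms in auto)
  then show ?thesis
  proof (eventually_elim, intro Cauchy_convergent metric_CauchyI)
    fix x and e :: real assume *: "\<forall>e>0. \<exists>m. \<forall>i. \<bar>S (m + i) x - S m x\<bar> \<le> e" and "e > 0"
    then have "e / 3 > 0" by simp
    with * obtain m where m: "\<And>i. \<bar>S (m + i) x - S m x\<bar> \<le> e / 3" by blast
    show "\<exists>n0. \<forall>p\<ge>n0. \<forall>q\<ge>n0. dist (S p x) (S q x) < e"
    proof (intro exI[of _ m] allI impI)
      fix p q assume "p \<ge> m" "q \<ge> m"
      then have "\<bar>S p x - S m x\<bar> \<le> e / 3" "\<bar>S q x - S m x\<bar> \<le> e / 3"
        using m[of "p - m"] m[of "q - m"] by auto
      with \<open>e > 0\<close> show "dist (S p x) (S q x) < e"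
        unfolding dist_real_def by linarith
    qed
  qed
qed

section \<open>Doob's maximal inequality\<close>

text \<open>The event is split by the first index \<open>i\<close> at which \<open>U\<close> exceeds
  \<open>c\<close>. That piece lies in \<open>F i\<close>, so on it \<open>c \<le> U i\<close>, and
  the submartingale inequality replaces \<open>U i\<close> by \<open>U n\<close>. Stating this
  inequality through set integrals avoids conditional expectations.\<close>

lemma doob_maximal_finite:
  fixes U :: "nat \<Rightarrow> 'a \<Rightarrow> real"
  assumes sub: "\<And>i. subalgebra M (F i)" and mono: "\<And>i j. i \<le> j \<Longrightarrow> sets (F i) \<subseteq> sets (F j)"
    and adapted: "\<And>i. U i \<in> borel_measurable (F i)"
    and int: "\<And>i. integrable M (U i)"
    and nonneg: "\<And>i. AE x in M. U i x \<ge> 0"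
    and submart: "\<And>i n A. i \<le> n \<Longrightarrow> A \<in> sets (F i) \<Longrightarrow>
        set_lebesgue_integral M A (U i) \<le> set_lebesgue_integral M A (U n)"
    and c: "c > 0"
  shows "prob {x \<in> space M. \<exists>i<n. U i x > c} \<le> expectation (U n) / c"
proof -
  define B where "B i = {x \<in> space M. U i x > c}" for i
  \<comment> \<open>\<open>D i\<close> is the event that \<open>i\<close> is the first index with
    \<open>U i > c\<close>.\<close>
  define D where "D = disjointed B"
  have spF: "space (F i) = space M" for i using sub[of i] by (simp add: subalgebra_def)
  have BF: "B i \<in> sets (F j)" if "i \<le> j" for i j
  proof -
    have "{x \<in> space (F i). U i x > c} \<in> sets (F i)" using adapted[of i] by measurable
    with mono[OF that] show ?thesis by (auto simp: B_def spF)
  qed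
  have DF: "D i \<in> sets (F i)" for i
    unfolding D_def disjointed_def using BF by (intro sets.Diff sets.finite_UN) auto
  have DM[measurable]: "D i \<in> events" for i using DF sub unfolding subalgebra_def by blast
  have DB: "D i \<subseteq> B i" for i unfolding D_def by (rule disjointed_subset)
  have disj: "disjoint_family_on D I" for I
    using disjoint_family_disjointed[of B] unfolding D_def disjoint_family_on_def by auto
  have Un: "{x \<in> space M. \<exists>i<n. U i x > c} = (\<Union>i\<in>{0..<n}. D i)"
    unfolding D_def finite_UN_disjointed_eq by (auto simp: B_def)
  have "c * prob (\<Union>i\<in>{0..<n}. D i) = (\<Sum>i\<in>{0..<n}. c * prob (D i))"
    by (subst finite_measure_finite_Union) (use disj in \<open>auto simp: sum_distrib_left\<close>)
  also have "\<dots> \<le> (\<Sum>i\<in>{0..<n}. set_lebesgue_integral M (D i) (U n))"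
  proof (rule sum_mono)
    fix i assume "i \<in> {0..<n}"
    then have i: "i \<le> n" by simp
    have "c * prob (D i) = set_lebesgue_integral M (D i) (\<lambda>_. c)"
      by (simp add: set_lebesgue_integral_def)
    also have "\<dots> \<le> set_lebesgue_integral M (D i) (U i)"
    proof (rule set_integral_mono)
      show "set_integrable M (D i) (\<lambda>_. c)"
        by (simp add: set_integrable_def integrable_real_indicator less_top[symmetric])
      show "set_integrable M (D i) (U i)" unfolding set_integrable_def
        using int[of i] by (intro integrable_mult_indicator) auto
      show "\<And>x. x \<in> D i \<Longrightarrow> c \<le> U i x" using DB[of i] by (auto simp: B_def)
    qed
    also have "\<dots> \<le> set_lebesgue_integral M (D i) (U n)" by (rule submart[OF i DF])
    finally show "c * prob (D i) \<le> set_lebesgue_integral M (D i) (U n)" .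
  qed
  also have "\<dots> = set_lebesgue_integral M (\<Union>i\<in>{0..<n}. D i) (U n)"
  proof (rule set_integral_finite_Union[symmetric])
    show "set_integrable M (D i) (U n)" if "i \<in> {0..<n}" for i unfolding set_integrable_def
      using int[of n] by (intro integrable_mult_indicator) auto
  qed (use disj in auto)
  also have "\<dots> \<le> expectation (U n)"
    unfolding set_lebesgue_integral_def
  proof (rule integral_mono_AE)
    show "integrable M (\<lambda>x. indicator (\<Union>i\<in>{0..<n}. D i) x *\<^sub>R U n x)"
      using int[of n] by (intro integrable_mult_indicator) auto
    show "AE x in M. indicator (\<Union>i\<in>{0..<n}. D i) x *\<^sub>R U n x \<le> U n x"
      using nonneg[of n] by eventually_elim (simp add: indicator_def)
  qed (rule int)
  finally show ?thesis unfolding Un using c by (simp add: field_simps)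
qed

text \<open>The finite-horizon events increase to the full one, so continuity of the measure carries
  the uniform bound over to an infinite horizon.\<close>

lemma doob_maximal:
  fixes U :: "nat \<Rightarrow> 'a \<Rightarrow> real"
  assumes sub: "\<And>i. subalgebra M (F i)" and mono: "\<And>i j. i \<le> j \<Longrightarrow> sets (F i) \<subseteq> sets (F j)"
    and adapted: "\<And>i. U i \<in> borel_measurable (F i)"
    and int: "\<And>i. integrable M (U i)"
    and nonneg: "\<And>i. AE x in M. U i x \<ge> 0"
    and submart: "\<And>i n A. i \<le> n \<Longrightarrow> A \<in> sets (F i) \<Longrightarrow>
        set_lebesgue_integral M A (U i) \<le> set_lebesgue_integral M A (U n)"
    and c: "c > 0"
    and B: "\<And>n. expectation (U n) \<le> B"
  shows "prob {x \<in> space M. \<exists>i. U i x > c} \<le> B / c"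
proof -
  have [measurable]: "U i \<in> borel_measurable M" for i using int by auto
  have eq: "{x \<in> space M. \<exists>i. U i x > c} = (\<Union>n. {x \<in> space M. \<exists>i<n. U i x > c})" by auto
  have "(\<lambda>n. prob {x \<in> space M. \<exists>i<n. U i x > c}) \<longlonglongrightarrow> prob (\<Union>n. {x \<in> space M. \<exists>i<n. U i x > c})"
  proof (rule finite_Lim_measure_incseq)
    show "incseq (\<lambda>n. {x \<in> space M. \<exists>i<n. U i x > c})"
      by (rule incseq_SucI) (blast intro: less_SucI)
  qed auto
  moreover have "prob {x \<in> space M. \<exists>i<n. U i x > c} \<le> B / c" for n
  proof -
    have "prob {x \<in> space M. \<exists>i<n. U i x > c} \<le> expectation (U n) / c"
      by (rule doob_maximal_finite[where F=F]) (use assms in auto)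
    also have "\<dots> \<le> B / c" using B[of n] c by (simp add: divide_right_mono)
    finally show ?thesis .
  qed
  ultimately show ?thesis unfolding eq by (intro LIMSEQ_le_const2) auto
qed

section \<open>Orthogonal sequences adapted to a filtration\<close>

text \<open>Index convention: \<open>D i\<close> is known at time \<open>Suc i\<close>, so the sum
  over \<open>j < i\<close> is known at time \<open>i\<close>. Together with square integrability
  this makes the partial sum an admissible test variable \<open>Z\<close> in the orthogonality
  condition for \<open>D i\<close> used below.\<close>

lemma orthogonal_partial_sum:
  fixes D :: "nat \<Rightarrow> 'a \<Rightarrow> real"
  assumes sub: "\<And>i. subalgebra M (F i)" and mono: "\<And>i j. i \<le> j \<Longrightarrow> sets (F i) \<subseteq> sets (F j)"
    and adapted: "\<And>i. D i \<in> borel_measurable (F (Suc i))"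
    and sq: "\<And>i. integrable M (\<lambda>x. (D i x)\<^sup>2)"
  shows "(\<lambda>x. \<Sum>j<i. D j x) \<in> borel_measurable (F i)"
    "integrable M (\<lambda>x. (\<Sum>j<i. D j x)\<^sup>2)"
proof -
  have spF: "space (F i) = space M" for i using sub[of i] by (simp add: subalgebra_def)
  show "(\<lambda>x. \<Sum>j<i. D j x) \<in> borel_measurable (F i)"
  proof (rule borel_measurable_sum)
    fix j assume "j \<in> {..<i}"
    then show "D j \<in> borel_measurable (F i)"
      using adapted[of j] mono[of "Suc j" i] by (auto simp: measurable_def spF)
  qed
  have DM: "D i \<in> borel_measurable M" for i
    using measurable_from_subalg[OF sub adapted] .
  show "integrable M (\<lambda>x. (\<Sum>j<i. D j x)\<^sup>2)"
    unfolding power2_eq_square sum_product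
    by (intro Bochner_Integration.integrable_sum integrable_mult_of_squares DM sq)
qed

text \<open>Orthogonality makes the squares of the partial sums a submartingale whose expectation is
  the sum of the variances. Doob's inequality is then applied to these squares at the threshold
  \<open>e^2\<close>.\<close>

lemma kolmogorov_maximal:
  fixes D :: "nat \<Rightarrow> 'a \<Rightarrow> real"
  assumes sub: "\<And>i. subalgebra M (F i)" and mono: "\<And>i j. i \<le> j \<Longrightarrow> sets (F i) \<subseteq> sets (F j)"
    and adapted: "\<And>i. D i \<in> borel_measurable (F (Suc i))"
    and sq: "\<And>i. integrable M (\<lambda>x. (D i x)\<^sup>2)"
    and orth: "\<And>i Z. Z \<in> borel_measurable (F i) \<Longrightarrow> integrable M (\<lambda>x. (Z x)\<^sup>2) \<Longrightarrow>
        expectation (\<lambda>x. Z x * D i x) = 0"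
    and B: "\<And>n. (\<Sum>i<n. expectation (\<lambda>x. (D i x)\<^sup>2)) \<le> B"
    and e: "e > 0"
  shows "prob {x \<in> space M. \<exists>n. \<bar>\<Sum>i<n. D i x\<bar> > e} \<le> B / e\<^sup>2"
proof -
  define S where "S n x = (\<Sum>i<n. D i x)" for n x
  have S: "S i \<in> borel_measurable (F i)" "integrable M (\<lambda>x. (S i x)\<^sup>2)" for i
    unfolding S_def[abs_def]
    by (rule orthogonal_partial_sum[where F=F]; use sub mono adapted sq in blast)+
  have DM[measurable]: "D i \<in> borel_measurable M" for i
    using measurable_from_subalg[OF sub adapted] .
  have SM[measurable]: "S n \<in> borel_measurable M" for n unfolding S_def by measurable
  \<comment> \<open>Pythagoras localised to \<open>A\<close>: the cross term vanishes because
    \<open>indicator A * S n\<close> is itself a square integrable test variable at time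
    \<open>n\<close>.\<close>
  have incr: "expectation (\<lambda>x. indicator A x * (S (Suc n) x)\<^sup>2)
      = expectation (\<lambda>x. indicator A x * (S n x)\<^sup>2) + expectation (\<lambda>x. indicator A x * (D n x)\<^sup>2)"
    if A: "A \<in> sets (F n)" for A n
  proof -
    have [measurable]: "A \<in> events" using A sub unfolding subalgebra_def by blast
    have i: "integrable M (\<lambda>x. indicator A x * (S n x)\<^sup>2)" "integrable M (\<lambda>x. indicator A x * (D n x)\<^sup>2)"
      using integrable_mult_indicator[OF _ S(2), of A] integrable_mult_indicator[OF _ sq, of A] by auto
    have ASq: "integrable M (\<lambda>x. (indicator A x * S n x)\<^sup>2)"
    proof -
      have "(\<lambda>x. (indicator A x * S n x)\<^sup>2) = (\<lambda>x. indicator A x * (S n x)\<^sup>2)"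
        by (rule ext) (simp add: indicator_def)
      with i(1) show ?thesis by simp
    qed
    have "(\<lambda>x. indicator A x * S n x) \<in> borel_measurable (F n)"
      using A S(1)[of n] by (intro borel_measurable_times) auto
    note o = orth[OF this ASq]
    have i3: "integrable M (\<lambda>x. (indicator A x * S n x) * D n x)"
      by (rule integrable_mult_of_squares) (use ASq sq in auto)
    have "expectation (\<lambda>x. indicator A x * (S (Suc n) x)\<^sup>2) = expectation (\<lambda>x.
       indicator A x * (S n x)\<^sup>2 + indicator A x * (D n x)\<^sup>2 + 2 * ((indicator A x * S n x) * D n x))"
    proof (rule Bochner_Integration.integral_cong[OF refl])
      fix x
      have "S (Suc n) x = S n x + D n x" by (simp add: S_def)
      then show "indicator A x * (S (Suc n) x)\<^sup>2 =
       indicator A x * (S n x)\<^sup>2 + indicator A x * (D n x)\<^sup>2 + 2 * ((indicator A x * S n x) * D n x)"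
        by (simp add: power2_sum algebra_simps)
    qed
    also have "\<dots> = expectation (\<lambda>x. indicator A x * (S n x)\<^sup>2) + expectation (\<lambda>x. indicator A x * (D n x)\<^sup>2) + 0"
      using i i3 o by simp
    finally show ?thesis by simp
  qed
  have var: "expectation (\<lambda>x. (S n x)\<^sup>2) = (\<Sum>i<n. expectation (\<lambda>x. (D i x)\<^sup>2))" for n
  proof (induction n)
    case (Suc n)
    have "space M \<in> sets (F n)" using sub[of n] sets.top[of "F n"] unfolding subalgebra_def by simp
    have sp: "expectation (\<lambda>x. indicator (space M) x * g x) = expectation g" for g :: "'a \<Rightarrow> real"
      by (rule Bochner_Integration.integral_cong) auto
    have "expectation (\<lambda>x. (S (Suc n) x)\<^sup>2) = expectation (\<lambda>x. (S n x)\<^sup>2) + expectation (\<lambda>x. (D n x)\<^sup>2)"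
      using incr[OF \<open>space M \<in> sets (F n)\<close>] by (simp only: sp)
    with Suc show ?case by simp
  qed (simp add: S_def)
  have "prob {x \<in> space M. \<exists>n. (S n x)\<^sup>2 > e\<^sup>2} \<le> B / e\<^sup>2"
  proof (rule doob_maximal[OF sub mono])
    show "(\<lambda>x. (S i x)\<^sup>2) \<in> borel_measurable (F i)" for i
      using S(1)[of i] by measurable
    fix i n A assume "i \<le> n" and A: "A \<in> sets (F i)"
    have "expectation (\<lambda>x. indicator A x * (S i x)\<^sup>2) \<le> expectation (\<lambda>x. indicator A x * (S n x)\<^sup>2)"
      using \<open>i \<le> n\<close>
    proof (induction rule: dec_induct)
      case (step n)
      then have "A \<in> sets (F n)" using A mono by blast
      moreover have "expectation (\<lambda>x. indicator A x * (D n x)\<^sup>2) \<ge> 0"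
        by (rule integral_nonneg_AE) simp
      ultimately show ?case using incr[of A n] step(3) by linarith
    qed simp
    then show "set_lebesgue_integral M A (\<lambda>x. (S i x)\<^sup>2) \<le> set_lebesgue_integral M A (\<lambda>x. (S n x)\<^sup>2)"
      by (simp add: set_lebesgue_integral_def)
  qed (use S(2) e B var in auto)
  moreover have "(S n x)\<^sup>2 > e\<^sup>2 \<longleftrightarrow> \<bar>S n x\<bar> > e" for n x
    using e abs_le_square_iff[of "S n x" e] by linarith
  ultimately show ?thesis by (simp add: S_def)
qed

text \<open>Kolmogorov's maximal inequality is applied to the series started at \<open>m\<close>,
  where the remaining variance is below \<open>d * e^2\<close>; this is exactly the tail condition
  of \<open>AE_convergent_of_tails\<close>.\<close>

lemma orthogonal_series_AE_summable:
  fixes D :: "nat \<Rightarrow> 'a \<Rightarrow> real"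
  assumes sub: "\<And>i. subalgebra M (F i)" and mono: "\<And>i j. i \<le> j \<Longrightarrow> sets (F i) \<subseteq> sets (F j)"
    and adapted: "\<And>i. D i \<in> borel_measurable (F (Suc i))"
    and sq: "\<And>i. integrable M (\<lambda>x. (D i x)\<^sup>2)"
    and orth: "\<And>i Z. Z \<in> borel_measurable (F i) \<Longrightarrow> integrable M (\<lambda>x. (Z x)\<^sup>2) \<Longrightarrow>
        expectation (\<lambda>x. Z x * D i x) = 0"
    and summable: "summable (\<lambda>i. expectation (\<lambda>x. (D i x)\<^sup>2))"
  shows "AE x in M. summable (\<lambda>i. D i x)"
proof -
  have DM[measurable]: "D i \<in> borel_measurable M" for i
    using measurable_from_subalg[OF sub adapted] .
  have "AE x in M. convergent (\<lambda>n. \<Sum>i<n. D i x)"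
  proof (rule AE_convergent_of_tails)
    fix e d :: real assume e: "e > 0" and d: "d > 0"
    let ?v = "\<lambda>i. expectation (\<lambda>x. (D i x)\<^sup>2)"
    have "(\<lambda>m. \<Sum>i. ?v (i + m)) \<longlonglongrightarrow> 0" using suminf_exist_split2[OF summable] by simp
    from LIMSEQ_D[OF this, of "d * e\<^sup>2"] e d obtain m where m: "\<bar>\<Sum>i. ?v (i + m)\<bar> < d * e\<^sup>2"
      by (auto simp: less_imp_le)
    \<comment> \<open>The series started at \<open>m\<close> is adapted to the filtration shifted by
      \<open>m\<close>, and its variances sum to a tail of the convergent series.\<close>
    have "prob {x \<in> space M. \<exists>n. \<bar>\<Sum>i<n. D (m + i) x\<bar> > e} \<le> (d * e\<^sup>2) / e\<^sup>2"
    proof (rule kolmogorov_maximal[where F="\<lambda>i. F (m + i)"])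
      fix n
      have "(\<Sum>i<n. ?v (m + i)) \<le> (\<Sum>i. ?v (i + m))"
        using sum_le_suminf[of "\<lambda>i. ?v (i + m)" "{..<n}"] summable
        using summable_iff_shift[of ?v m] by (simp add: add.commute)
      with m show "(\<Sum>i<n. ?v (m + i)) \<le> d * e\<^sup>2" by linarith
    qed (use sub mono adapted sq orth e in auto)
    moreover have "(\<Sum>i<m + n. D i x) - (\<Sum>i<m. D i x) = (\<Sum>i<n. D (m + i) x)" for n x
      by (induction n) auto
    ultimately show "\<exists>m. prob {x \<in> space M. \<exists>n. \<bar>(\<Sum>i<m + n. D i x) - (\<Sum>i<m. D i x)\<bar> > e} \<le> d"
      using e by (auto intro!: exI[of _ m])
  qed measurable
  then show ?thesis by eventually_elim (simp add: summable_iff_convergent)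
qed

text \<open>Bessel's inequality, by following the residual \<open>Z - (\<Sum>i<n. c i * D i)\<close> of an approximate projection.\<close>

lemma orthogonal_sequence_weakly_null:
  fixes D :: "nat \<Rightarrow> 'a \<Rightarrow> real"
  assumes sub: "\<And>i. subalgebra M (F i)" and mono: "\<And>i j. i \<le> j \<Longrightarrow> sets (F i) \<subseteq> sets (F j)"
    and adapted: "\<And>i. D i \<in> borel_measurable (F (Suc i))"
    and sq: "\<And>i. integrable M (\<lambda>x. (D i x)\<^sup>2)"
    and orth: "\<And>i Z. Z \<in> borel_measurable (F i) \<Longrightarrow> integrable M (\<lambda>x. (Z x)\<^sup>2) \<Longrightarrow>
        expectation (\<lambda>x. Z x * D i x) = 0"
    and B: "\<And>i. expectation (\<lambda>x. (D i x)\<^sup>2) \<le> B" "B > 0"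
    and Z[measurable]: "Z \<in> borel_measurable M" "integrable M (\<lambda>x. (Z x)\<^sup>2)"
  shows "(\<lambda>i. expectation (\<lambda>x. Z x * D i x)) \<longlonglongrightarrow> 0"
proof -
  define a where "a i = expectation (\<lambda>x. Z x * D i x)" for i
  \<comment> \<open>The common bound \<open>B\<close> replaces the variance of \<open>D i\<close>,
    which could vanish. This \<open>c i\<close> minimises \<open>B * c^2 - 2 * a i * c\<close>, so
    each step lowers the squared norm of the residual by at least
    \<open>(a i)^2 / B\<close>.\<close>
  define c where "c i = a i / B" for i
  define S where "S n x = (\<Sum>i<n. c i * D i x)" for n x
  have DM[measurable]: "D i \<in> borel_measurable M" for i
    using measurable_from_subalg[OF sub adapted] .
  have SM[measurable]: "S n \<in> borel_measurable M" for n unfolding S_def by measurable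
  have S: "S i \<in> borel_measurable (F i)" "integrable M (\<lambda>x. (S i x)\<^sup>2)" for i
    unfolding S_def[abs_def]
    by (rule orthogonal_partial_sum[where F=F]; use sub mono adapted sq in \<open>simp add: power_mult_distrib\<close>)+
  have i1: "integrable M (\<lambda>x. Z x * D n x)" "integrable M (\<lambda>x. S n x * D n x)" "integrable M (\<lambda>x. Z x * S n x)" for n
    by (rule integrable_mult_of_squares; use Z sq S in simp)+
  have i2: "integrable M (\<lambda>x. (Z x - S n x)\<^sup>2)" for n
    using Z(2) S(2)[of n] i1(3)[of n] by (simp add: power2_diff mult.assoc)
  have "expectation (\<lambda>x. (Z x - S n x)\<^sup>2) + (\<Sum>i<n. (a i)\<^sup>2) / B \<le> expectation (\<lambda>x. (Z x)\<^sup>2)" for n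
  proof (induction n)
    case (Suc n)
    have "expectation (\<lambda>x. (Z x - S (Suc n) x)\<^sup>2) = expectation (\<lambda>x. (Z x - S n x)\<^sup>2
        - 2 * c n * (Z x * D n x - S n x * D n x) + (c n)\<^sup>2 * (D n x)\<^sup>2)"
      by (rule Bochner_Integration.integral_cong[OF refl]) (simp add: S_def power2_eq_square algebra_simps)
    also have "\<dots> = expectation (\<lambda>x. (Z x - S n x)\<^sup>2) - 2 * c n * (a n - 0)
        + (c n)\<^sup>2 * expectation (\<lambda>x. (D n x)\<^sup>2)"
      using i1[of n] i2[of n] sq[of n] orth[OF S] unfolding a_def by simp
    also have "(c n)\<^sup>2 * expectation (\<lambda>x. (D n x)\<^sup>2) \<le> (c n)\<^sup>2 * B"
      by (rule mult_left_mono[OF B(1)]) simp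
    also have "expectation (\<lambda>x. (Z x - S n x)\<^sup>2) - 2 * c n * (a n - 0) + (c n)\<^sup>2 * B
        = expectation (\<lambda>x. (Z x - S n x)\<^sup>2) - (a n)\<^sup>2 / B"
      using B(2) by (simp add: c_def field_simps power2_eq_square)
    finally show ?case using Suc by (simp add: add_divide_distrib)
  qed (simp add: S_def)
  moreover have "expectation (\<lambda>x. (Z x - S n x)\<^sup>2) \<ge> 0" for n
    by (rule integral_nonneg_AE) simp
  ultimately have "(\<Sum>i<n. (a i)\<^sup>2) / B \<le> expectation (\<lambda>x. (Z x)\<^sup>2)" for n
    by (meson add_le_cancel_right add_increasing order_trans order_refl)
  then have "(\<Sum>i<n. (a i)\<^sup>2) \<le> expectation (\<lambda>x. (Z x)\<^sup>2) * B" for n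
    using B(2) by (simp add: pos_divide_le_eq)
  then have "summable (\<lambda>i. (a i)\<^sup>2)"
    by (intro summableI_nonneg_bounded) auto
  then have "(\<lambda>i. (a i)\<^sup>2) \<longlonglongrightarrow> 0" by (rule summable_LIMSEQ_zero)
  from tendsto_real_sqrt[OF this] show ?thesis
    unfolding a_def[symmetric] by (simp add: tendsto_rabs_zero_iff)
qed

section \<open>Limits of integrable sequences\<close>

text \<open>Fatou's lemma is used on nonnegative integrals, where no integrability of the limit has
  to be known in advance; the finite bound then yields it.\<close>

lemma L1_fatou:
  fixes u :: "nat \<Rightarrow> 'a \<Rightarrow> real"
  assumes [measurable]: "\<And>n. integrable M (u n)" "v \<in> borel_measurable M"
    and lim: "AE x in M. (\<lambda>n. u n x) \<longlonglongrightarrow> v x"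
    and B: "\<And>n. expectation (\<lambda>x. \<bar>u n x\<bar>) \<le> B"
  shows "integrable M v" "expectation (\<lambda>x. \<bar>v x\<bar>) \<le> B"
proof -
  have "expectation (\<lambda>x. \<bar>u 0 x\<bar>) \<ge> 0" by (rule integral_nonneg_AE) simp
  with B[of 0] have B0: "B \<ge> 0" by linarith
  have "(\<integral>\<^sup>+x. norm (v x) \<partial>M) = (\<integral>\<^sup>+x. liminf (\<lambda>n. ennreal \<bar>u n x\<bar>) \<partial>M)"
  proof (rule nn_integral_cong_AE, use lim in eventually_elim)
    case (elim x)
    then have "(\<lambda>n. ennreal \<bar>u n x\<bar>) \<longlonglongrightarrow> ennreal \<bar>v x\<bar>"
      by (intro tendsto_ennrealI tendsto_rabs)
    then show ?case using lim_imp_Liminf[OF sequentially_bot] by fastforce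
  qed
  also have "\<dots> \<le> liminf (\<lambda>n. \<integral>\<^sup>+x. ennreal \<bar>u n x\<bar> \<partial>M)"
    by (rule nn_integral_liminf) simp
  also have "\<dots> \<le> liminf (\<lambda>n. ennreal B)"
  proof (rule Liminf_mono, rule always_eventually, rule allI)
    fix n show "(\<integral>\<^sup>+x. ennreal \<bar>u n x\<bar> \<partial>M) \<le> ennreal B"
      using B[of n] assms(1)[of n] by (subst nn_integral_eq_integral) (auto intro: ennreal_leI)
  qed
  also have "\<dots> = ennreal B" by (simp add: Liminf_const)
  finally have *: "(\<integral>\<^sup>+x. norm (v x) \<partial>M) \<le> ennreal B" .
  also have "\<dots> < \<infinity>" by simp
  finally show int: "integrable M v" by (intro integrableI_bounded) auto
  then have "(\<integral>\<^sup>+x. norm (v x) \<partial>M) = ennreal (expectation (\<lambda>x. \<bar>v x\<bar>))"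
    by (subst nn_integral_eq_integral[symmetric]) auto
  with * B0 show "expectation (\<lambda>x. \<bar>v x\<bar>) \<le> B" by simp
qed

text \<open>Testing against the bounded variable \<open>sgn (V - W)\<close> turns equality of the
  weak limits into a vanishing integral of \<open>|V - W|\<close>.\<close>

lemma weak_L1_limit_unique:
  assumes V: "weak_L1_limit M Y V" and W: "weak_L1_limit M Y W"
  shows "AE x in M. V x = W x"
proof -
  have i: "integrable M V" "integrable M W" using V W by (auto simp: weak_L1_limit_def)
  then have [measurable]: "V \<in> borel_measurable M" "W \<in> borel_measurable M" by auto
  define Z where "Z x = sgn (V x - W x)" for x
  have Z[measurable]: "Z \<in> borel_measurable M" unfolding Z_def[abs_def] by measurable
  have Zb: "bounded (Z ` space M)" by (auto intro!: boundedI[where B=1] simp: Z_def sgn_if)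
  have iZ: "integrable M (\<lambda>x. U x * Z x)" if "integrable M U" for U
    by (rule Bochner_Integration.integrable_bound[OF that]) (use that in \<open>auto simp: Z_def sgn_if\<close>)
  have "expectation (\<lambda>x. V x * Z x) = expectation (\<lambda>x. W x * Z x)"
  proof (rule LIMSEQ_unique)
    show "(\<lambda>n. expectation (\<lambda>x. Y n x * Z x)) \<longlonglongrightarrow> expectation (\<lambda>x. V x * Z x)"
      using V Z Zb by (simp add: weak_L1_limit_def)
    show "(\<lambda>n. expectation (\<lambda>x. Y n x * Z x)) \<longlonglongrightarrow> expectation (\<lambda>x. W x * Z x)"
      using W Z Zb by (simp add: weak_L1_limit_def)
  qed
  then have "expectation (\<lambda>x. V x * Z x - W x * Z x) = 0" using iZ i by simp
  moreover have "(\<lambda>x. V x * Z x - W x * Z x) = (\<lambda>x. \<bar>V x - W x\<bar>)"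
    by (auto simp: Z_def sgn_if)
  ultimately have "AE x in M. \<bar>V x - W x\<bar> = 0"
    using i by (subst integral_nonneg_eq_0_iff_AE[symmetric]) auto
  then show ?thesis by eventually_elim simp
qed

end

section \<open>C.i.d. sequences\<close>

locale cid_process = prob_space M
  for M :: "'a measure" +
  fixes E :: "'b measure" and X :: "nat \<Rightarrow> 'a \<Rightarrow> 'b"
  assumes cid: "cid M E X"
begin

lemma X_Suc_measurable[measurable]: "X (Suc i) \<in> measurable M E"
  using cid unfolding cid_def by simp

lemma X_measurable: "i \<ge> 1 \<Longrightarrow> X i \<in> measurable M E"
  using cid unfolding cid_def by simp

lemma space_past: "space (past M E X n) = space M"
  unfolding past_def by (simp add: space_measure_of_conv)

lemma subalgebra_past_cid: "subalgebra M (past M E X n)"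
  by (rule subalgebra_past) (rule X_measurable)

lemma past_gen_subset: "(\<Union>i\<in>{1..n}. {X i -` A \<inter> space M | A. A \<in> sets E}) \<subseteq> Pow (space M)"
  by auto

lemma sets_past_mono: "m \<le> n \<Longrightarrow> sets (past M E X m) \<subseteq> sets (past M E X n)"
  unfolding past_def sets_measure_of[OF past_gen_subset]
  by (rule sigma_sets_mono') (rule UN_mono, auto)

lemma X_measurable_past:
  assumes "1 \<le> i" "i \<le> n"
  shows "X i \<in> measurable (past M E X n) E"
proof (rule measurableI)
  fix x assume "x \<in> space (past M E X n)"
  then show "X i x \<in> space E" using measurable_space[OF X_measurable[OF assms(1)]] by (simp add: space_past)
next
  fix A assume "A \<in> sets E"
  then show "X i -` A \<inter> space (past M E X n) \<in> sets (past M E X n)"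
    unfolding space_past unfolding past_def sets_measure_of[OF past_gen_subset]
    by (intro sigma_sets.Basic UN_I[of i]) (use assms in auto)
qed

sublocale past: finite_measure_subalgebra M "past M E X n" for n
  by unfold_locales (rule subalgebra_past_cid)

lemma past_measurable_mono:
  "g \<in> borel_measurable (past M E X m) \<Longrightarrow> m \<le> n \<Longrightarrow> g \<in> borel_measurable (past M E X n)"
  using sets_past_mono[of m n] by (auto simp: measurable_def space_past)

lemma past_sets_events: "A \<in> sets (past M E X n) \<Longrightarrow> A \<in> events"
  using subalgebra_past_cid[of n] unfolding subalgebra_def by blast

text \<open>The definition of \<open>cid\<close> speaks of bounded functions only. Rewriting it as
  equality of laws under \<open>M\<close> restricted to a past event \<open>A\<close> makes it
  available for unbounded functions.\<close>

lemma distr_past_eq: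
  assumes A: "A \<in> sets (past M E X n)" and k: "k > n"
  shows "distr (density M (indicator A)) E (X k) = distr (density M (indicator A)) E (X (Suc n))"
proof (rule measure_eqI)
  fix B assume "B \<in> sets (distr (density M (indicator A)) E (X k))"
  then have B[measurable]: "B \<in> sets E" by simp
  have AM[measurable]: "A \<in> events" by (rule past_sets_events[OF A])
  \<comment> \<open>The mass of \<open>B\<close> becomes a set integral of the conditional
    expectation of an indicator, to which the definition of \<open>cid\<close> applies because
    indicators are bounded.\<close>
  have em: "emeasure (distr (density M (indicator A)) E (X j)) B
      = ennreal (set_lebesgue_integral M A (real_cond_exp M (past M E X n) (\<lambda>x. indicator B (X j x))))"
    if "j > n" for j
  proof -
    have [measurable]: "X j \<in> measurable M E" using that X_measurable[of j] by simp
    have "emeasure (distr (density M (indicator A)) E (X j)) B = emeasure M (A \<inter> (X j -` B \<inter> space M))"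
      by (simp add: emeasure_distr emeasure_restricted)
    also have "\<dots> = ennreal (prob (A \<inter> (X j -` B \<inter> space M)))" by (rule emeasure_eq_measure)
    also have "prob (A \<inter> (X j -` B \<inter> space M)) = expectation (indicator (A \<inter> (X j -` B \<inter> space M)))"
      by simp
    also have "\<dots> = set_lebesgue_integral M A (\<lambda>x. indicator B (X j x))"
      unfolding set_lebesgue_integral_def
      by (rule Bochner_Integration.integral_cong) (auto simp: indicator_def)
    also have "\<dots> = set_lebesgue_integral M A (real_cond_exp M (past M E X n) (\<lambda>x. indicator B (X j x)))"
    proof (rule past.real_cond_exp_intA[OF _ A])
      show "integrable M (\<lambda>x. indicat_real B (X j x))"
        by (rule integrable_const_bound[where B=1]) auto
    qed
    finally show ?thesis .
  qed
  have "(\<lambda>x. indicat_real B x) \<in> borel_measurable E" "bounded ((\<lambda>x. indicat_real B x) ` space E)"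
    by (auto intro!: boundedI[where B=1])
  then have "AE x in M. real_cond_exp M (past M E X n) (\<lambda>x. indicat_real B (X k x)) x
      = real_cond_exp M (past M E X n) (\<lambda>x. indicat_real B (X (Suc n) x)) x"
    using cid k unfolding cid_def by blast
  then have "set_lebesgue_integral M A (real_cond_exp M (past M E X n) (\<lambda>x. indicator B (X k x)))
      = set_lebesgue_integral M A (real_cond_exp M (past M E X n) (\<lambda>x. indicator B (X (Suc n) x)))"
    unfolding set_lebesgue_integral_def
    by (intro integral_cong_AE) (auto elim!: eventually_mono intro!: borel_measurable_scaleR borel_measurable_cond_exp2)
  then show "emeasure (distr (density M (indicator A)) E (X k)) B
      = emeasure (distr (density M (indicator A)) E (X (Suc n))) B"
    using em[OF k] em[of "Suc n"] by simp
qed simp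

text \<open>Both sides are integrals of \<open>f\<close> against the same law. If \<open>f\<close>
  is not integrable there, both take the default value 0.\<close>

lemma set_integral_X:
  assumes A: "A \<in> sets (past M E X n)" and k: "k > n" and f[measurable]: "f \<in> borel_measurable E"
  shows "set_lebesgue_integral M A (\<lambda>x. f (X k x) :: real) = set_lebesgue_integral M A (\<lambda>x. f (X (Suc n) x))"
proof -
  have [measurable]: "A \<in> events" by (rule past_sets_events[OF A])
  have "set_lebesgue_integral M A (\<lambda>x. f (X j x)) = integral\<^sup>L (distr (density M (indicator A)) E (X j)) f"
    if "j > n" for j
  proof -
    have [measurable]: "X j \<in> measurable M E" using that X_measurable[of j] by simp
    have "integral\<^sup>L (distr (density M (indicator A)) E (X j)) f
       = integral\<^sup>L (density M (\<lambda>x. ennreal (indicator A x))) (\<lambda>x. f (X j x))"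
      by (subst integral_distr) (simp_all add: ennreal_indicator)
    also have "\<dots> = set_lebesgue_integral M A (\<lambda>x. f (X j x))"
      unfolding set_lebesgue_integral_def by (rule integral_density) auto
    finally show ?thesis by simp
  qed
  then show ?thesis using distr_past_eq[OF A k] k by simp
qed

text \<open>This is the case of the trivial past: time 0 and the event \<open>space M\<close>, on
  which restricting the measure changes nothing.\<close>

lemma distr_X_eq: "distr M E (X (Suc k)) = distr M E (X 1)"
proof -
  have "density M (indicator (space M)) = density M (\<lambda>_. 1)"
    by (rule density_cong) (auto simp: indicator_def)
  then have "density M (indicator (space M)) = M" by (simp add: density_1)
  moreover have "space M \<in> sets (past M E X 0)" using sets.top[of "past M E X 0"] by (simp add: space_past)
  ultimately show ?thesis using distr_past_eq[of "space M" 0 "Suc k"] by simp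
qed

lemma integrable_X:
  "f \<in> cid_class M E X \<Longrightarrow> integrable M (\<lambda>x. f (X (Suc k) x))"
  using integrable_distr_eq[of "X (Suc k)" M E f] integrable_distr_eq[of "X 1" M E f] distr_X_eq[of k]
  unfolding cid_class_def by (simp add: X_measurable)

lemma expectation_X:
  assumes [measurable]: "f \<in> borel_measurable E"
  shows "expectation (\<lambda>x. f (X (Suc k) x) :: real) = expectation (\<lambda>x. f (X 1 x))"
  using integral_distr[of "X (Suc k)" M E f] integral_distr[of "X 1" M E f] distr_X_eq[of k]
  by (simp add: X_measurable)

lemma cid_class_measurable[measurable_dest]: "f \<in> cid_class M E X \<Longrightarrow> f \<in> borel_measurable E"
  unfolding cid_class_def by simp

lemma cid_class_dominated:
  assumes f: "f \<in> cid_class M E X" and g[measurable]: "g \<in> borel_measurable E"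
    and le: "\<And>y. \<bar>g y\<bar> \<le> \<bar>f y\<bar>"
  shows "g \<in> cid_class M E X"
proof -
  have [measurable]: "X 1 \<in> measurable M E" using X_measurable[of 1] by simp
  have "integrable M (\<lambda>x. g (X 1 x))"
    by (rule Bochner_Integration.integrable_bound[of M "\<lambda>x. f (X 1 x)"])
       (use f le in \<open>auto simp: cid_class_def\<close>)
  then show ?thesis by (simp add: cid_class_def)
qed

lemma cid_class_bounded:
  assumes [measurable]: "g \<in> borel_measurable E" and "\<forall>y\<in>space E. \<bar>g y\<bar> \<le> C"
  shows "g \<in> cid_class M E X"
proof -
  have [measurable]: "X 1 \<in> measurable M E" using X_measurable[of 1] by simp
  have "integrable M (\<lambda>x. g (X 1 x))"
    by (rule integrable_const_bound[where B=C])
       (use assms(2) measurable_space[OF X_measurable[of 1]] in auto)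
  then show ?thesis by (simp add: cid_class_def)
qed

lemma cid_class_add: "f \<in> cid_class M E X \<Longrightarrow> g \<in> cid_class M E X \<Longrightarrow> (\<lambda>y. f y + g y) \<in> cid_class M E X"
  unfolding cid_class_def by auto

lemma cid_class_abs: "f \<in> cid_class M E X \<Longrightarrow> (\<lambda>y. \<bar>f y\<bar>) \<in> cid_class M E X"
  unfolding cid_class_def by auto

section \<open>Predictive means and their limits\<close>

definition pred :: "('b \<Rightarrow> real) \<Rightarrow> nat \<Rightarrow> 'a \<Rightarrow> real" where
  "pred f n = real_cond_exp M (past M E X n) (\<lambda>x. f (X (Suc n) x))"

lemma pred_measurable_past[simp]: "pred f n \<in> borel_measurable (past M E X n)"
  unfolding pred_def by (rule borel_measurable_cond_exp)

lemma pred_measurable[measurable]: "pred f n \<in> borel_measurable M"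
  unfolding pred_def by (rule borel_measurable_cond_exp2)

lemma pred_integrable: "f \<in> cid_class M E X \<Longrightarrow> integrable M (pred f n)"
  unfolding pred_def by (rule past.real_cond_exp_int) (rule integrable_X)

text \<open>Allowing every later \<open>k\<close> encodes the martingale property: two predictive
  means integrated over an event of the earlier past can be compared through one common future
  observation.\<close>

lemma set_integral_pred:
  assumes f: "f \<in> cid_class M E X" and A: "A \<in> sets (past M E X n)" and k: "k > n"
  shows "set_lebesgue_integral M A (pred f n) = set_lebesgue_integral M A (\<lambda>x. f (X k x))"
  using past.real_cond_exp_intA[OF integrable_X[OF f, of n] A] set_integral_X[OF A k, of f] f
  by (simp add: pred_def cid_class_def)

text \<open>Extends the defining identity of \<open>cid\<close> from bounded functions to the whole
  class, since conditional expectations are characterised by their integrals over past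
  events.\<close>

lemma pred_AE_eq:
  assumes f: "f \<in> cid_class M E X" and k: "k > n"
  shows "AE x in M. real_cond_exp M (past M E X n) (\<lambda>x. f (X k x)) x = pred f n x"
proof (rule past.real_cond_exp_charact)
  show "integrable M (\<lambda>x. f (X k x))" using integrable_X[OF f, of "k - 1"] k by simp
qed (use f k set_integral_pred pred_integrable in auto)

text \<open>A factor known at time \<open>n\<close> passes through the conditional expectation. With
  \<open>k = Suc n\<close> this makes the prediction error orthogonal to the past; with later
  \<open>k\<close> it makes the increments of the predictive means orthogonal to the past.\<close>

lemma integral_mult_pred:
  assumes f: "f \<in> cid_class M E X" and k: "k > n"
    and Z: "Z \<in> borel_measurable (past M E X n)" and int: "integrable M (\<lambda>x. Z x * f (X k x))"
  shows "expectation (\<lambda>x. Z x * pred f n x) = expectation (\<lambda>x. Z x * f (X k x))"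
proof -
  have [measurable]: "X k \<in> measurable M E" using k X_measurable[of k] by simp
  have [measurable]: "f \<in> borel_measurable E" using f by measurable
  have [measurable]: "Z \<in> borel_measurable M" by (rule measurable_from_subalg[OF subalgebra_past_cid Z])
  have "expectation (\<lambda>x. Z x * f (X k x))
      = expectation (\<lambda>x. Z x * real_cond_exp M (past M E X n) (\<lambda>x. f (X k x)) x)"
    by (rule past.real_cond_exp_intg(2)[OF int Z, symmetric]) measurable
  also have "\<dots> = expectation (\<lambda>x. Z x * pred f n x)"
    by (rule integral_cong_AE) (use pred_AE_eq[OF f k] in \<open>auto elim!: eventually_mono\<close>)
  finally show ?thesis by simp
qed

lemma pred_add:
  assumes "f \<in> cid_class M E X" "g \<in> cid_class M E X"
  shows "AE x in M. pred (\<lambda>y. f y + g y) n x = pred f n x + pred g n x"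
  unfolding pred_def by (rule past.real_cond_exp_add) (intro integrable_X assms)+

lemma pred_mono:
  assumes "f \<in> cid_class M E X" "g \<in> cid_class M E X" "\<And>y. y \<in> space E \<Longrightarrow> f y \<le> g y"
  shows "AE x in M. pred f n x \<le> pred g n x"
  unfolding pred_def
  by (rule past.real_cond_exp_mono)
     (use integrable_X assms measurable_space[OF X_Suc_measurable] in auto)

lemma pred_nonneg:
  assumes "f \<in> cid_class M E X" "\<And>y. y \<in> space E \<Longrightarrow> 0 \<le> f y"
  shows "AE x in M. 0 \<le> pred f n x"
  unfolding pred_def
  by (rule past.real_cond_exp_pos)
     (use integrable_X[OF assms(1)] assms(2) measurable_space[OF X_Suc_measurable] in auto)

lemma abs_pred_le:
  assumes "f \<in> cid_class M E X"
  shows "AE x in M. \<bar>pred f n x\<bar> \<le> pred (\<lambda>y. \<bar>f y\<bar>) n x"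
proof -
  have neg: "AE x in M. real_cond_exp M (past M E X n) (\<lambda>x. - 1 * \<bar>f (X (Suc n) x)\<bar>) x
      = - 1 * real_cond_exp M (past M E X n) (\<lambda>x. \<bar>f (X (Suc n) x)\<bar>) x"
    by (rule past.real_cond_exp_cmult) (use integrable_X[OF cid_class_abs[OF assms]] in simp)
  have "AE x in M. real_cond_exp M (past M E X n) (\<lambda>x. - 1 * \<bar>f (X (Suc n) x)\<bar>) x \<le> pred f n x"
    unfolding pred_def
    by (rule past.real_cond_exp_mono)
      (use integrable_X[OF cid_class_abs[OF assms]] integrable_X[OF assms] in auto)
  moreover have "AE x in M. pred f n x \<le> pred (\<lambda>y. \<bar>f y\<bar>) n x"
    by (rule pred_mono) (use assms cid_class_abs in auto)
  ultimately show ?thesis using neg by eventually_elim (simp add: pred_def)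
qed

lemma abs_pred_le_const:
  assumes f: "f \<in> borel_measurable E" and C: "\<forall>y\<in>space E. \<bar>f y\<bar> \<le> C"
  shows "AE x in M. \<bar>pred f n x\<bar> \<le> C"
proof -
  have "f \<in> cid_class M E X" by (rule cid_class_bounded[OF f C])
  then have i: "integrable M (\<lambda>x. f (X (Suc n) x))" by (rule integrable_X)
  have "AE x in M. f (X (Suc n) x) \<le> C" "AE x in M. f (X (Suc n) x) \<ge> - C"
    using C measurable_space[OF X_Suc_measurable] by (auto simp: abs_le_iff minus_le_iff)
  from past.real_cond_exp_le_c[where n=n, OF i this(1)] past.real_cond_exp_ge_c[where n=n, OF i this(2)]
  show ?thesis unfolding pred_def by eventually_elim auto
qed

lemma expectation_pred:
  assumes f: "f \<in> cid_class M E X"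
  shows "expectation (pred f n) = expectation (\<lambda>x. f (X 1 x))"
proof -
  have "expectation (pred f n) = expectation (\<lambda>x. f (X (Suc n) x))"
    unfolding pred_def by (rule past.real_cond_exp_int) (rule integrable_X[OF f])
  then show ?thesis using expectation_X[of f n] f by (simp add: cid_class_def)
qed

lemma expectation_abs_pred_le:
  assumes f: "f \<in> cid_class M E X"
  shows "expectation (\<lambda>x. \<bar>pred f n x\<bar>) \<le> expectation (\<lambda>x. \<bar>f (X 1 x)\<bar>)"
proof -
  have "expectation (\<lambda>x. \<bar>pred f n x\<bar>) \<le> expectation (pred (\<lambda>y. \<bar>f y\<bar>) n)"
    by (rule integral_mono_AE) (use pred_integrable cid_class_abs f abs_pred_le in auto)
  then show ?thesis using expectation_pred[OF cid_class_abs[OF f]] by simp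
qed

text \<open>For nonnegative \<open>f\<close> the predictive means form a nonnegative martingale of
  constant expectation, so Doob's inequality applies with a bound independent of time.\<close>

lemma pred_maximal:
  assumes f: "f \<in> cid_class M E X" and nn: "\<And>y. y \<in> space E \<Longrightarrow> 0 \<le> f y" and c: "c > 0"
  shows "prob {x \<in> space M. \<exists>n. pred f n x > c} \<le> expectation (\<lambda>x. f (X 1 x)) / c"
proof (rule doob_maximal[where F="past M E X"])
  fix i n A assume "i \<le> n" "A \<in> sets (past M E X i)"
  moreover from this have "A \<in> sets (past M E X n)" using sets_past_mono by blast
  ultimately show "set_lebesgue_integral M A (pred f i) \<le> set_lebesgue_integral M A (pred f n)"
    using set_integral_pred[OF f, of A i "Suc n"] set_integral_pred[OF f, of A n "Suc n"] by simp
qed (use subalgebra_past_cid sets_past_mono pred_integrable[OF f] pred_nonneg[OF f nn] c expectation_pred[OF f] in auto)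

section \<open>Convergence of the predictive means\<close>

text \<open>This is the absolute truncation error \<open>|f - trunc f N|\<close> for the cut-off
  \<open>trunc\<close> introduced below.\<close>

definition excess :: "('b \<Rightarrow> real) \<Rightarrow> nat \<Rightarrow> 'b \<Rightarrow> real" where
  "excess f N y = (if \<bar>f y\<bar> \<le> real N then 0 else \<bar>f y\<bar>)"

lemma excess_cid_class: "f \<in> cid_class M E X \<Longrightarrow> excess f N \<in> cid_class M E X"
  by (rule cid_class_dominated, assumption) (auto simp: excess_def[abs_def])

lemma excess_tendsto:
  assumes f: "f \<in> cid_class M E X"
  shows "(\<lambda>N. expectation (\<lambda>x. excess f N (X 1 x))) \<longlonglongrightarrow> 0"
proof -
  have i: "integrable M (\<lambda>x. f (X 1 x))" "f \<in> borel_measurable E" using f by (auto simp: cid_class_def)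
  have [measurable]: "X 1 \<in> measurable M E" using X_measurable[of 1] by simp
  have "(\<lambda>N. expectation (\<lambda>x. excess f N (X 1 x))) \<longlonglongrightarrow> expectation (\<lambda>x. 0)"
  proof (rule integral_dominated_convergence[where w="\<lambda>x. \<bar>f (X 1 x)\<bar>"])
    show "AE x in M. (\<lambda>N. excess f N (X 1 x)) \<longlonglongrightarrow> 0"
    proof (rule AE_I2)
      fix x
      obtain N0 :: nat where "\<bar>f (X 1 x)\<bar> \<le> real N0" using real_arch_simple by blast
      then have "\<forall>N\<ge>N0. excess f N (X 1 x) = 0" by (auto simp: excess_def)
      then show "(\<lambda>N. excess f N (X 1 x)) \<longlonglongrightarrow> 0"
        by (intro tendsto_eventually) (auto simp: eventually_sequentially)
    qed
  qed (use i excess_cid_class[OF f] in \<open>auto simp: excess_def cid_class_def\<close>)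
  then show ?thesis by simp
qed

text \<open>The maximal inequality bounds the supremum over all times by the expectation of one
  \<open>excess f N (X 1)\<close>, which tends to 0 with \<open>N\<close>. Hence truncation errors
  are small uniformly in time, almost surely.\<close>

lemma pred_excess_small:
  assumes f: "f \<in> cid_class M E X"
  shows "AE x in M. \<forall>e>0. \<exists>N. \<forall>i. \<bar>pred (excess f N) i x\<bar> \<le> e"
proof (rule AE_uniformly_small)
  fix e d :: real assume e: "e > 0" and d: "d > 0"
  from LIMSEQ_D[OF excess_tendsto[OF f], of "d * e"] e d obtain N
    where N: "\<bar>expectation (\<lambda>x. excess f N (X 1 x))\<bar> < d * e" by auto
  have nn: "AE x in M. \<forall>i. 0 \<le> pred (excess f N) i x"
    unfolding AE_all_countable
    by (intro allI pred_nonneg excess_cid_class[OF f]) (simp add: excess_def)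
  have "prob {x \<in> space M. \<exists>i. \<bar>pred (excess f N) i x\<bar> > e} = prob {x \<in> space M. \<exists>i. pred (excess f N) i x > e}"
    by (rule finite_measure_eq_AE) (use nn in \<open>auto elim!: eventually_mono\<close>)
  also have "\<dots> \<le> expectation (\<lambda>x. excess f N (X 1 x)) / e"
    by (rule pred_maximal) (use excess_cid_class[OF f] e in \<open>auto simp: excess_def\<close>)
  also have "\<dots> \<le> d" using N e by (simp add: pos_divide_le_eq)
  finally show "\<exists>N. prob {x \<in> space M. \<exists>i. \<bar>pred (excess f N) i x\<bar> > e} \<le> d" by blast
qed measurable

text \<open>Orthogonality makes the squared norms of the increments telescope to a difference of
  second moments of predictive means, at most \<open>C^2\<close>. The increments are therefore an
  almost surely summable orthogonal series.\<close>

lemma pred_AE_convergent_bounded: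
  assumes f[measurable]: "f \<in> borel_measurable E" and C: "\<forall>y\<in>space E. \<bar>f y\<bar> \<le> C"
  shows "AE x in M. convergent (\<lambda>n. pred f n x)"
proof -
  have H: "f \<in> cid_class M E X" by (rule cid_class_bounded[OF f C])
  define D where "D i x = pred f (Suc i) x - pred f i x" for i x
  have sq: "integrable M (\<lambda>x. (pred f i x)\<^sup>2)" for i
  proof (rule integrable_const_bound[where B="C\<^sup>2"])
    show "AE x in M. norm ((pred f i x)\<^sup>2) \<le> C\<^sup>2"
      using abs_pred_le_const[OF f C, of i]
      by eventually_elim (auto simp: abs_le_square_iff[symmetric])
  qed measurable
  have sqX: "integrable M (\<lambda>x. (f (X (Suc i) x))\<^sup>2)" for i
  proof (rule integrable_const_bound[where B="C\<^sup>2"])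
    show "AE x in M. norm ((f (X (Suc i) x))\<^sup>2) \<le> C\<^sup>2"
    proof (rule AE_I2)
      fix x assume "x \<in> space M"
      then have "\<bar>f (X (Suc i) x)\<bar> \<le> C" using C measurable_space[OF X_Suc_measurable] by blast
      then show "norm ((f (X (Suc i) x))\<^sup>2) \<le> C\<^sup>2" by (auto simp: abs_le_square_iff[symmetric])
    qed
  qed measurable
  \<comment> \<open>The martingale property in \<open>L^2\<close>: both sides equal the expectation
    of \<open>Z * f (X (Suc j))\<close>, an observation lying in the future of both times.\<close>
  have orth: "expectation (\<lambda>x. Z x * pred f j x) = expectation (\<lambda>x. Z x * pred f i x)"
    if Z: "Z \<in> borel_measurable (past M E X i)" "integrable M (\<lambda>x. (Z x)\<^sup>2)" and ij: "i \<le> j" for i j Z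
  proof -
    have [measurable]: "Z \<in> borel_measurable M" by (rule measurable_from_subalg[OF subalgebra_past_cid Z(1)])
    have int: "integrable M (\<lambda>x. Z x * f (X (Suc j) x))"
      by (rule integrable_mult_of_squares) (use Z sqX in simp_all)
    have "expectation (\<lambda>x. Z x * pred f j x) = expectation (\<lambda>x. Z x * f (X (Suc j) x))"
      by (rule integral_mult_pred[OF H _ past_measurable_mono[OF Z(1) ij] int]) simp
    moreover have "expectation (\<lambda>x. Z x * pred f i x) = expectation (\<lambda>x. Z x * f (X (Suc j) x))"
      by (rule integral_mult_pred[OF H _ Z(1) int]) (use ij in simp)
    ultimately show ?thesis by simp
  qed
  have int2: "integrable M (\<lambda>x. Z x * pred f i x)"
    if "Z \<in> borel_measurable M" "integrable M (\<lambda>x. (Z x)\<^sup>2)" for i Z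
    by (rule integrable_mult_of_squares) (use that sq in simp_all)
  have Dsq: "integrable M (\<lambda>x. (D i x)\<^sup>2)" for i
    unfolding D_def power2_diff using sq int2[OF _ sq] by (simp add: mult.assoc)
  have Dexp: "expectation (\<lambda>x. (D i x)\<^sup>2) = expectation (\<lambda>x. (pred f (Suc i) x)\<^sup>2) - expectation (\<lambda>x. (pred f i x)\<^sup>2)" for i
  proof -
    have "expectation (\<lambda>x. (D i x)\<^sup>2) = expectation (\<lambda>x. (pred f (Suc i) x)\<^sup>2 + (pred f i x)\<^sup>2
       - 2 * (pred f i x * pred f (Suc i) x))"
      by (rule Bochner_Integration.integral_cong) (auto simp: D_def power2_diff algebra_simps)
    also have "\<dots> = expectation (\<lambda>x. (pred f (Suc i) x)\<^sup>2) + expectation (\<lambda>x. (pred f i x)\<^sup>2)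
       - 2 * expectation (\<lambda>x. pred f i x * pred f (Suc i) x)"
      using sq int2[OF _ sq] by simp
    also have "expectation (\<lambda>x. pred f i x * pred f (Suc i) x) = expectation (\<lambda>x. pred f i x * pred f i x)"
      by (rule orth) (use sq in auto)
    finally show ?thesis by (simp add: power2_eq_square)
  qed
  have "AE x in M. summable (\<lambda>i. D i x)"
  proof (rule orthogonal_series_AE_summable[where F="past M E X"])
    fix i and Z :: "'a \<Rightarrow> real" assume Z: "Z \<in> borel_measurable (past M E X i)" "integrable M (\<lambda>x. (Z x)\<^sup>2)"
    have ZM: "Z \<in> borel_measurable M" by (rule measurable_from_subalg[OF subalgebra_past_cid Z(1)])
    show "expectation (\<lambda>x. Z x * D i x) = 0"
      using orth[OF Z, of "Suc i"] int2[OF ZM Z(2)] by (simp add: D_def right_diff_distrib)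
  next
    show "D i \<in> borel_measurable (past M E X (Suc i))" for i
      unfolding D_def[abs_def]
      by (rule borel_measurable_diff[OF pred_measurable_past past_measurable_mono[OF pred_measurable_past]]) simp
  next
    have "(\<Sum>i<n. expectation (\<lambda>x. (D i x)\<^sup>2)) \<le> C\<^sup>2" for n
    proof -
      have "(\<Sum>i<n. expectation (\<lambda>x. (D i x)\<^sup>2)) = expectation (\<lambda>x. (pred f n x)\<^sup>2) - expectation (\<lambda>x. (pred f 0 x)\<^sup>2)"
        unfolding Dexp by (rule sum_lessThan_telescope)
      also have "\<dots> \<le> expectation (\<lambda>x. (pred f n x)\<^sup>2)"
        by simp
      also have "\<dots> \<le> expectation (\<lambda>x. C\<^sup>2)"
      proof (rule integral_mono_AE)
        show "AE x in M. (pred f n x)\<^sup>2 \<le> C\<^sup>2"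
          using abs_pred_le_const[OF f C, of n]
          by eventually_elim (auto simp: abs_le_square_iff[symmetric])
      qed (use sq in auto)
      finally show ?thesis by (simp add: prob_space)
    qed
    then show "summable (\<lambda>i. expectation (\<lambda>x. (D i x)\<^sup>2))"
      by (intro summableI_nonneg_bounded) auto
  qed (use subalgebra_past_cid sets_past_mono Dsq in auto)
  then show ?thesis
  proof eventually_elim
    case (elim x)
    have "(\<Sum>i<n. D i x) + pred f 0 x = pred f n x" for n
      unfolding D_def by (subst sum_lessThan_telescope) simp
    moreover have "convergent (\<lambda>n. (\<Sum>i<n. D i x) + pred f 0 x)"
      using elim by (intro convergent_add convergent_const) (simp add: summable_iff_convergent)
    ultimately show ?case by simp
  qed
qed

text \<open>Values beyond the level are set to 0 rather than clipped to it, so the error in absolute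
  value is exactly \<open>excess f N\<close>.\<close>

definition trunc :: "('b \<Rightarrow> real) \<Rightarrow> nat \<Rightarrow> 'b \<Rightarrow> real" where
  "trunc f N y = (if \<bar>f y\<bar> \<le> real N then f y else 0)"

lemma trunc_measurable: "f \<in> borel_measurable E \<Longrightarrow> trunc f N \<in> borel_measurable E"
  unfolding trunc_def[abs_def] by (simp add: measurable_If)

lemma abs_trunc_le: "\<bar>trunc f N y\<bar> \<le> real N"
  by (simp add: trunc_def)

lemma trunc_cid_class: "f \<in> cid_class M E X \<Longrightarrow> trunc f N \<in> cid_class M E X"
  by (rule cid_class_dominated, assumption) (auto simp: trunc_def[abs_def])

lemma tail_cid_class: "f \<in> cid_class M E X \<Longrightarrow> (\<lambda>y. f y - trunc f N y) \<in> cid_class M E X"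
  by (rule cid_class_dominated, assumption) (auto simp: trunc_def[abs_def])

lemma abs_tail: "\<bar>f y - trunc f N y\<bar> = excess f N y"
  by (simp add: trunc_def excess_def)

lemma pred_trunc_le:
  assumes f: "f \<in> cid_class M E X"
  shows "AE x in M. \<bar>pred f n x - pred (trunc f N) n x\<bar> \<le> pred (excess f N) n x"
proof -
  have "AE x in M. pred (\<lambda>y. trunc f N y + (f y - trunc f N y)) n x = pred (trunc f N) n x + pred (\<lambda>y. f y - trunc f N y) n x"
    by (rule pred_add) (use f trunc_cid_class tail_cid_class in auto)
  then have "AE x in M. pred f n x = pred (trunc f N) n x + pred (\<lambda>y. f y - trunc f N y) n x"
    by simp
  moreover have "AE x in M. \<bar>pred (\<lambda>y. f y - trunc f N y) n x\<bar> \<le> pred (\<lambda>y. \<bar>f y - trunc f N y\<bar>) n x"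
    by (rule abs_pred_le) (rule tail_cid_class[OF f])
  ultimately show ?thesis unfolding abs_tail by eventually_elim simp
qed

text \<open>The truncated sequences are Cauchy, and they approximate \<open>pred f\<close> with an
  error uniform in time by \<open>pred_excess_small\<close>; a three-term estimate transfers the
  Cauchy property.\<close>

lemma pred_AE_convergent:
  assumes f: "f \<in> cid_class M E X"
  shows "AE x in M. convergent (\<lambda>n. pred f n x)"
proof -
  have "AE x in M. \<forall>N. convergent (\<lambda>n. pred (trunc f N) n x)"
    unfolding AE_all_countable
    by (intro allI pred_AE_convergent_bounded trunc_measurable) (use f abs_trunc_le in \<open>auto simp: cid_class_def\<close>)
  moreover have "AE x in M. \<forall>N n. \<bar>pred f n x - pred (trunc f N) n x\<bar> \<le> pred (excess f N) n x"
    unfolding AE_all_countable by (intro allI pred_trunc_le f)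
  ultimately show ?thesis using pred_excess_small[OF f]
  proof (eventually_elim, intro Cauchy_convergent metric_CauchyI)
    fix x and e :: real
    assume conv: "\<forall>N. convergent (\<lambda>n. pred (trunc f N) n x)"
      and le: "\<forall>N n. \<bar>pred f n x - pred (trunc f N) n x\<bar> \<le> pred (excess f N) n x"
      and small: "\<forall>e>0. \<exists>N. \<forall>i. \<bar>pred (excess f N) i x\<bar> \<le> e"
      and e: "e > 0"
    then obtain N where N: "\<And>i. \<bar>pred (excess f N) i x\<bar> \<le> e / 3" by (metis divide_pos_pos zero_less_numeral)
    have close: "\<bar>pred f n x - pred (trunc f N) n x\<bar> \<le> e / 3" for n using le N[of n] by (metis abs_ge_self order_trans)
    have "Cauchy (\<lambda>n. pred (trunc f N) n x)" using conv by (simp add: convergent_Cauchy)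
    from metric_CauchyD[OF this, of "e / 3"] e obtain n0
      where n0: "\<And>p q. p \<ge> n0 \<Longrightarrow> q \<ge> n0 \<Longrightarrow> \<bar>pred (trunc f N) p x - pred (trunc f N) q x\<bar> < e / 3"
      by (auto simp: dist_real_def)
    show "\<exists>n0. \<forall>p\<ge>n0. \<forall>q\<ge>n0. dist (pred f p x) (pred f q x) < e"
    proof (intro exI[of _ n0] allI impI)
      fix p q assume "p \<ge> n0" "q \<ge> n0"
      from n0[OF this] close[of p] close[of q] show "dist (pred f p x) (pred f q x) < e"
        unfolding dist_real_def by linarith
    qed
  qed
qed

section \<open>The limit variable and its identification\<close>

text \<open>A concrete version of the limit, built from paths. Where the predictive means diverge, a
  null set for \<open>f\<close> in the class, \<open>lim\<close> has an unspecified value.\<close>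

definition V :: "('b \<Rightarrow> real) \<Rightarrow> 'a \<Rightarrow> real" where
  "V f x = lim (\<lambda>n. pred f n x)"

lemma V_measurable[measurable]: "V f \<in> borel_measurable M"
  unfolding V_def[abs_def] by (rule borel_measurable_lim_metric) measurable

lemma pred_tendsto_V: "f \<in> cid_class M E X \<Longrightarrow> AE x in M. (\<lambda>n. pred f n x) \<longlonglongrightarrow> V f x"
  unfolding V_def convergent_LIMSEQ_iff[symmetric] by (rule pred_AE_convergent)

text \<open>Fatou's lemma applies since all predictive means satisfy the same \<open>L^1\<close>
  bound. The resulting contraction is what carries truncation errors over to the limit.\<close>

lemma
  assumes f: "f \<in> cid_class M E X"
  shows V_integrable: "integrable M (V f)"
    and V_L1_le: "expectation (\<lambda>x. \<bar>V f x\<bar>) \<le> expectation (\<lambda>x. \<bar>f (X 1 x)\<bar>)"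
  by (rule L1_fatou[OF pred_integrable[OF f] V_measurable pred_tendsto_V[OF f] expectation_abs_pred_le[OF f]])+

lemma V_add:
  assumes "f \<in> cid_class M E X" "g \<in> cid_class M E X"
  shows "AE x in M. V (\<lambda>y. f y + g y) x = V f x + V g x"
proof -
  have "AE x in M. \<forall>n. pred (\<lambda>y. f y + g y) n x = pred f n x + pred g n x"
    unfolding AE_all_countable by (intro allI pred_add assms)
  then show ?thesis
    using pred_tendsto_V[OF assms(1)] pred_tendsto_V[OF assms(2)] pred_tendsto_V[OF cid_class_add[OF assms]]
  proof eventually_elim
    case (elim x)
    then have "(\<lambda>n. pred f n x + pred g n x) \<longlonglongrightarrow> V (\<lambda>y. f y + g y) x" by simp
    moreover have "(\<lambda>n. pred f n x + pred g n x) \<longlonglongrightarrow> V f x + V g x"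
      using elim by (intro tendsto_add)
    ultimately show ?case by (rule LIMSEQ_unique)
  qed
qed

lemma abs_V_le_const:
  assumes f: "f \<in> borel_measurable E" and C: "\<forall>y\<in>space E. \<bar>f y\<bar> \<le> C"
  shows "AE x in M. \<bar>V f x\<bar> \<le> C"
proof -
  have "AE x in M. \<forall>n. \<bar>pred f n x\<bar> \<le> C"
    unfolding AE_all_countable by (intro allI abs_pred_le_const[OF f C])
  then show ?thesis using pred_tendsto_V[OF cid_class_bounded[OF f C]]
    by eventually_elim (rule LIMSEQ_le_const2[OF tendsto_rabs], auto)
qed

text \<open>The observation is split into prediction error and predictive mean. The errors are
  orthogonal and bounded, hence weakly null; the means converge by dominated convergence.\<close>

lemma weak_limit_bounded:
  assumes f[measurable]: "f \<in> borel_measurable E" and C: "\<forall>y\<in>space E. \<bar>f y\<bar> \<le> C"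
    and Z[measurable]: "Z \<in> borel_measurable M" and K: "\<And>x. x \<in> space M \<Longrightarrow> \<bar>Z x\<bar> \<le> K"
  shows "(\<lambda>n. expectation (\<lambda>x. f (X (Suc n) x) * Z x)) \<longlonglongrightarrow> expectation (\<lambda>x. V f x * Z x)"
proof -
  have H: "f \<in> cid_class M E X" by (rule cid_class_bounded[OF f C])
  define D where "D i x = f (X (Suc i) x) - pred f i x" for i x
  have C0: "C \<ge> 0"
  proof -
    obtain x where "x \<in> space M" using not_empty by blast
    then have "\<bar>f (X 1 x)\<bar> \<le> C" using C measurable_space[OF X_measurable[of 1]] by simp
    then show ?thesis by linarith
  qed
  have Db: "AE x in M. (D i x)\<^sup>2 \<le> (2 * C)\<^sup>2" for i
    using abs_pred_le_const[OF f C, of i] AE_space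
  proof eventually_elim
    case (elim x)
    then have "\<bar>f (X (Suc i) x)\<bar> \<le> C" using C measurable_space[OF X_Suc_measurable] by blast
    with elim C0 have "\<bar>D i x\<bar> \<le> \<bar>2 * C\<bar>" unfolding D_def by linarith
    then show ?case by (simp only: abs_le_square_iff)
  qed
  have DM[measurable]: "D i \<in> borel_measurable M" for i unfolding D_def[abs_def] by measurable
  have Dsq: "integrable M (\<lambda>x. (D i x)\<^sup>2)" for i
    by (rule integrable_const_bound[where B="(2 * C)\<^sup>2"]) (use Db[of i] in auto)
  have Zb: "integrable M (\<lambda>x. (Z x)\<^sup>2)"
  proof (rule integrable_const_bound[where B="K\<^sup>2"])
    show "AE x in M. norm ((Z x)\<^sup>2) \<le> K\<^sup>2"
    proof (rule AE_I2)
      fix x assume "x \<in> space M"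
      from K[OF this] show "norm ((Z x)\<^sup>2) \<le> K\<^sup>2" by (auto simp: abs_le_square_iff[symmetric])
    qed
  qed measurable
  have iX: "integrable M (\<lambda>x. W x * f (X (Suc n) x))" "integrable M (\<lambda>x. W x * pred f n x)"
    if "W \<in> borel_measurable M" "integrable M (\<lambda>x. (W x)\<^sup>2)" for n W
  proof -
    have W: "integrable M W" by (rule square_integrable_imp_integrable) (use that in auto)
    have WC: "integrable M (\<lambda>x. W x * C)" using W by simp
    have le: "\<bar>W x * v\<bar> \<le> \<bar>W x * C\<bar>" if "\<bar>v\<bar> \<le> C" for x v
      using that by (auto simp: abs_mult intro!: mult_left_mono)
    have "AE x in M. \<bar>f (X (Suc n) x)\<bar> \<le> C"
      using C measurable_space[OF X_Suc_measurable] by (intro AE_I2) blast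
    then show "integrable M (\<lambda>x. W x * f (X (Suc n) x))"
      by (intro Bochner_Integration.integrable_bound[OF WC])
         (use that le in \<open>auto elim!: eventually_mono\<close>)
    show "integrable M (\<lambda>x. W x * pred f n x)"
      using abs_pred_le_const[OF f C, of n]
      by (intro Bochner_Integration.integrable_bound[OF WC])
         (use that le in \<open>auto elim!: eventually_mono\<close>)
  qed
  have "(\<lambda>i. expectation (\<lambda>x. Z x * D i x)) \<longlonglongrightarrow> 0"
  \<comment> \<open>The summand 1 in \<open>B\<close> keeps the bound positive when
    \<open>C = 0\<close>.\<close>
  proof (rule orthogonal_sequence_weakly_null[where F="past M E X" and B="(2 * C)\<^sup>2 + 1"])
    show "D i \<in> borel_measurable (past M E X (Suc i))" for i
      unfolding D_def[abs_def]
      by (rule borel_measurable_diff[OF measurable_compose[OF X_measurable_past f]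
            past_measurable_mono[OF pred_measurable_past]]) simp_all
    show "expectation (\<lambda>x. (D i x)\<^sup>2) \<le> (2 * C)\<^sup>2 + 1" for i
    proof -
      have "expectation (\<lambda>x. (D i x)\<^sup>2) \<le> expectation (\<lambda>x. (2 * C)\<^sup>2)"
        by (rule integral_mono_AE) (use Dsq Db in auto)
      then show ?thesis by (simp add: prob_space)
    qed
    show "(2 * C)\<^sup>2 + 1 > 0" by (simp add: add_nonneg_pos)
    fix i and W :: "'a \<Rightarrow> real" assume W: "W \<in> borel_measurable (past M E X i)" "integrable M (\<lambda>x. (W x)\<^sup>2)"
    have WM: "W \<in> borel_measurable M" by (rule measurable_from_subalg[OF subalgebra_past_cid W(1)])
    show "expectation (\<lambda>x. W x * D i x) = 0"
      using integral_mult_pred[OF H _ W(1), of "Suc i"] iX[OF WM W(2), of i]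
      by (simp add: D_def right_diff_distrib)
  qed (use subalgebra_past_cid sets_past_mono Dsq Zb in auto)
  moreover have "(\<lambda>n. expectation (\<lambda>x. pred f n x * Z x)) \<longlonglongrightarrow> expectation (\<lambda>x. V f x * Z x)"
  proof (rule integral_dominated_convergence[where w="\<lambda>x. C * K"])
    show "AE x in M. (\<lambda>n. pred f n x * Z x) \<longlonglongrightarrow> V f x * Z x"
      using pred_tendsto_V[OF H] by eventually_elim (intro tendsto_intros)
    show "AE x in M. norm (pred f n x * Z x) \<le> C * K" for n
      using abs_pred_le_const[OF f C, of n] AE_space
      by eventually_elim (use K C0 in \<open>auto simp: abs_mult intro!: mult_mono\<close>)
  qed auto
  ultimately have "(\<lambda>n. expectation (\<lambda>x. Z x * D n x) + expectation (\<lambda>x. pred f n x * Z x)) \<longlonglongrightarrow> 0 + expectation (\<lambda>x. V f x * Z x)"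
    by (rule tendsto_add)
  moreover have "expectation (\<lambda>x. Z x * D n x) + expectation (\<lambda>x. pred f n x * Z x) = expectation (\<lambda>x. f (X (Suc n) x) * Z x)" for n
    using iX[OF Z Zb, of n] by (simp add: D_def right_diff_distrib mult.commute)
  ultimately show ?thesis by simp
qed

lemma expectation_excess_X:
  assumes "f \<in> cid_class M E X"
  shows "integrable M (\<lambda>x. excess f N (X (Suc n) x))"
    "expectation (\<lambda>x. excess f N (X (Suc n) x)) = expectation (\<lambda>x. excess f N (X 1 x))"
proof -
  have H: "excess f N \<in> cid_class M E X" by (rule excess_cid_class[OF assms])
  show "integrable M (\<lambda>x. excess f N (X (Suc n) x))" by (rule integrable_X[OF H])
  show "expectation (\<lambda>x. excess f N (X (Suc n) x)) = expectation (\<lambda>x. excess f N (X 1 x))"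
    by (rule expectation_X) (use H in \<open>simp add: cid_class_def\<close>)
qed

text \<open>By additivity the difference is almost surely the limit variable of the tail
  \<open>f - trunc f N\<close>, to which the \<open>L^1\<close> contraction \<open>V_L1_le\<close>
  applies.\<close>

lemma V_trunc_L1:
  assumes f: "f \<in> cid_class M E X"
  shows "expectation (\<lambda>x. \<bar>V f x - V (trunc f N) x\<bar>) \<le> expectation (\<lambda>x. excess f N (X 1 x))"
proof -
  have "AE x in M. V (\<lambda>y. trunc f N y + (f y - trunc f N y)) x = V (trunc f N) x + V (\<lambda>y. f y - trunc f N y) x"
    by (rule V_add) (use f trunc_cid_class tail_cid_class in auto)
  then have "AE x in M. \<bar>V f x - V (trunc f N) x\<bar> = \<bar>V (\<lambda>y. f y - trunc f N y) x\<bar>"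
    by eventually_elim simp
  then have "expectation (\<lambda>x. \<bar>V f x - V (trunc f N) x\<bar>) = expectation (\<lambda>x. \<bar>V (\<lambda>y. f y - trunc f N y) x\<bar>)"
    by (intro integral_cong_AE) auto
  also have "\<dots> \<le> expectation (\<lambda>x. \<bar>f (X 1 x) - trunc f N (X 1 x)\<bar>)"
    by (rule V_L1_le) (rule tail_cid_class[OF f])
  finally show ?thesis by (simp add: abs_tail)
qed

text \<open>Truncation reduces to bounded \<open>f\<close>: since the observations are identically
  distributed, the error is uniform in \<open>n\<close>.\<close>

lemma weak_L1_limit_V:
  assumes f: "f \<in> cid_class M E X"
  shows "weak_L1_limit M (\<lambda>n x. f (X n x)) (V f)"
  unfolding weak_L1_limit_def
proof (intro conjI ballI impI)
  show "integrable M (V f)" by (rule V_integrable[OF f])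
  fix Z :: "'a \<Rightarrow> real" assume Z[measurable]: "Z \<in> borel_measurable M" and "bounded (Z ` space M)"
  then obtain K where K: "\<And>x. x \<in> space M \<Longrightarrow> \<bar>Z x\<bar> \<le> K" unfolding bounded_iff by auto
  have K0: "K \<ge> 0" proof -
    obtain x where "x \<in> space M" using not_empty by blast
    from K[OF this] show ?thesis by linarith
  qed
  have iZ: "integrable M (\<lambda>x. U x * Z x)" if "integrable M U" for U
  proof (rule Bochner_Integration.integrable_bound[of M "\<lambda>x. U x * K"])
    show "AE x in M. norm (U x * Z x) \<le> norm (U x * K)"
      using K K0 by (intro AE_I2) (auto simp: abs_mult intro!: mult_left_mono)
  qed (use that in auto)
  \<comment> \<open>Integration against \<open>Z\<close> is Lipschitz in \<open>L^1\<close> with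
    constant \<open>K\<close>.\<close>
  have EZ: "\<bar>expectation (\<lambda>x. U x * Z x) - expectation (\<lambda>x. W x * Z x)\<bar> \<le> expectation (\<lambda>x. \<bar>U x - W x\<bar>) * K"
    if "integrable M U" "integrable M W" for U W
  proof -
    have "expectation (\<lambda>x. U x * Z x) - expectation (\<lambda>x. W x * Z x) = expectation (\<lambda>x. (U x - W x) * Z x)"
      using iZ that by (simp add: left_diff_distrib)
    also have "\<bar>\<dots>\<bar> \<le> expectation (\<lambda>x. \<bar>(U x - W x) * Z x\<bar>)" by (rule integral_abs_bound)
    also have "\<dots> \<le> expectation (\<lambda>x. \<bar>U x - W x\<bar> * K)"
    proof (rule integral_mono)
      show "integrable M (\<lambda>x. \<bar>(U x - W x) * Z x\<bar>)" by (intro integrable_abs iZ) (use that in simp)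
    qed (use that K in \<open>auto simp: abs_mult intro!: mult_left_mono\<close>)
    finally show ?thesis by simp
  qed
  let ?u = "\<lambda>n. expectation (\<lambda>x. f (X (Suc n) x) * Z x) - expectation (\<lambda>x. V f x * Z x)"
  let ?a = "\<lambda>N n. \<bar>expectation (\<lambda>x. trunc f N (X (Suc n) x) * Z x) - expectation (\<lambda>x. V (trunc f N) x * Z x)\<bar>"
  \<comment> \<open>The factor 2 accounts for truncating \<open>f\<close> both in the observation
    and in the limit variable.\<close>
  let ?b = "\<lambda>N. 2 * (expectation (\<lambda>x. excess f N (X 1 x)) * K)"
  have "?u \<longlonglongrightarrow> 0"
  proof (rule tendsto_zero_approx)
    show "?a N \<longlonglongrightarrow> 0" for N
    proof -
      have "(\<lambda>n. expectation (\<lambda>x. trunc f N (X (Suc n) x) * Z x)) \<longlonglongrightarrow> expectation (\<lambda>x. V (trunc f N) x * Z x)"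
        by (rule weak_limit_bounded[OF trunc_measurable _ Z K]) (use f abs_trunc_le in \<open>auto simp: cid_class_def\<close>)
      then show ?thesis by (simp add: LIM_zero tendsto_rabs_zero)
    qed
    show "?b \<longlonglongrightarrow> 0"
      using tendsto_mult_right_zero[OF tendsto_mult_left_zero[OF excess_tendsto[OF f]]] by simp
    fix N n
    have "\<bar>expectation (\<lambda>x. f (X (Suc n) x) * Z x) - expectation (\<lambda>x. trunc f N (X (Suc n) x) * Z x)\<bar>
        \<le> expectation (\<lambda>x. excess f N (X 1 x)) * K"
      using EZ[OF integrable_X[OF f, of n] integrable_X[OF trunc_cid_class[OF f], of N n]]
        expectation_excess_X(2)[OF f, of N n] by (simp add: abs_tail)
    moreover have "\<bar>expectation (\<lambda>x. V f x * Z x) - expectation (\<lambda>x. V (trunc f N) x * Z x)\<bar>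
        \<le> expectation (\<lambda>x. excess f N (X 1 x)) * K"
      by (rule order_trans[OF EZ[OF V_integrable[OF f] V_integrable[OF trunc_cid_class[OF f]]]
            mult_right_mono[OF V_trunc_L1[OF f] K0]])
    ultimately show "\<bar>?u n\<bar> \<le> ?a N n + ?b N" by linarith
  qed
  then have "(\<lambda>n. expectation (\<lambda>x. f (X (Suc n) x) * Z x)) \<longlonglongrightarrow> expectation (\<lambda>x. V f x * Z x)"
    by (rule LIM_zero_cancel)
  \<comment> \<open>Shifting the index discards the unconstrained term \<open>X 0\<close>.\<close>
  then show "(\<lambda>n. expectation (\<lambda>x. f (X n x) * Z x)) \<longlonglongrightarrow> expectation (\<lambda>x. V f x * Z x)"
    by (rule LIMSEQ_imp_Suc)
qed

text \<open>Existence, shown by \<open>V f\<close>, makes the \<open>SOME\<close> in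
  \<open>cid_limit\<close> a genuine weak limit; uniqueness then identifies it with
  \<open>V f\<close> almost surely.\<close>

lemma
  assumes f: "f \<in> cid_class M E X"
  shows cid_limit_integrable: "integrable M (cid_limit M X f)"
    and cid_limit_AE_eq_V: "AE x in M. V f x = cid_limit M X f x"
proof -
  have *: "weak_L1_limit M (\<lambda>n x. f (X n x)) (cid_limit M X f)"
    unfolding cid_limit_def by (rule someI[where P="weak_L1_limit M (\<lambda>n x. f (X n x))", OF weak_L1_limit_V[OF f]])
  then show "integrable M (cid_limit M X f)" by (simp add: weak_L1_limit_def)
  show "AE x in M. V f x = cid_limit M X f x"
    by (rule weak_L1_limit_unique[OF weak_L1_limit_V[OF f] *])
qed

section \<open>Truncation at growing levels\<close>

text \<open>Centring at the conditional mean can only lower the second moment, as the cross term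
  equals the second moment of \<open>pred f n\<close>. Identical distribution makes the bound
  independent of \<open>n\<close>.\<close>

lemma predictive_variance_le:
  assumes f[measurable]: "f \<in> borel_measurable E" and C: "\<forall>y\<in>space E. \<bar>f y\<bar> \<le> C"
  shows "integrable M (\<lambda>x. (f (X (Suc n) x) - pred f n x)\<^sup>2)"
    "expectation (\<lambda>x. (f (X (Suc n) x) - pred f n x)\<^sup>2) \<le> expectation (\<lambda>x. (f (X 1 x))\<^sup>2)"
proof -
  have H: "f \<in> cid_class M E X" by (rule cid_class_bounded[OF f C])
  have fC: "AE x in M. \<bar>f (X (Suc n) x)\<bar> \<le> C"
    using C measurable_space[OF X_Suc_measurable] by (intro AE_I2) blast
  have sqX: "integrable M (\<lambda>x. (f (X (Suc n) x))\<^sup>2)"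
    by (rule integrable_const_bound[where B="C\<^sup>2"])
       (use fC in \<open>auto elim!: eventually_mono simp: abs_le_square_iff[symmetric]\<close>)
  have sqp: "integrable M (\<lambda>x. (pred f n x)\<^sup>2)"
    by (rule integrable_const_bound[where B="C\<^sup>2"])
       (use abs_pred_le_const[OF f C, of n] in \<open>auto elim!: eventually_mono simp: abs_le_square_iff[symmetric]\<close>)
  have mix: "integrable M (\<lambda>x. pred f n x * f (X (Suc n) x))"
    by (rule integrable_mult_of_squares) (use sqX sqp in simp_all)
  show "integrable M (\<lambda>x. (f (X (Suc n) x) - pred f n x)\<^sup>2)"
    unfolding power2_diff using sqX sqp mix by (simp add: mult_ac)
  have "expectation (\<lambda>x. (f (X (Suc n) x) - pred f n x)\<^sup>2)
      = expectation (\<lambda>x. (f (X (Suc n) x))\<^sup>2 + (pred f n x)\<^sup>2 - 2 * (pred f n x * f (X (Suc n) x)))"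
    by (rule Bochner_Integration.integral_cong) (auto simp: power2_diff algebra_simps)
  also have "\<dots> = expectation (\<lambda>x. (f (X (Suc n) x))\<^sup>2) + expectation (\<lambda>x. (pred f n x)\<^sup>2)
      - 2 * expectation (\<lambda>x. pred f n x * f (X (Suc n) x))"
    using sqX sqp mix by simp
  also have "expectation (\<lambda>x. pred f n x * f (X (Suc n) x)) = expectation (\<lambda>x. (pred f n x)\<^sup>2)"
    using integral_mult_pred[OF H _ pred_measurable_past mix] by (simp add: power2_eq_square)
  also have "expectation (\<lambda>x. (f (X (Suc n) x))\<^sup>2) + expectation (\<lambda>x. (pred f n x)\<^sup>2)
      - 2 * expectation (\<lambda>x. (pred f n x)\<^sup>2) \<le> expectation (\<lambda>x. (f (X (Suc n) x))\<^sup>2)"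
    by simp
  also have "\<dots> = expectation (\<lambda>x. (f (X 1 x))\<^sup>2)"
    by (rule expectation_X[of "\<lambda>y. (f y)\<^sup>2"]) measurable
  finally show "expectation (\<lambda>x. (f (X (Suc n) x) - pred f n x)\<^sup>2) \<le> expectation (\<lambda>x. (f (X 1 x))\<^sup>2)" .
qed

text \<open>Borel-Cantelli: all observations have the law of \<open>X 1\<close>, so the
  probabilities of exceeding the levels \<open>Suc i\<close> sum to at most the expectation of
  \<open>|f(X 1)|\<close>.\<close>

lemma AE_eventually_eq_trunc:
  assumes f: "f \<in> cid_class M E X"
  shows "AE x in M. eventually (\<lambda>i. trunc f (Suc i) (X (Suc (i + r)) x) = f (X (Suc (i + r)) x)) sequentially"
proof -
  have [measurable]: "f \<in> borel_measurable E" and [measurable]: "X 1 \<in> measurable M E"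
    using f X_measurable[of 1] by (auto simp: cid_class_def)
  have iabs: "integrable M (\<lambda>x. \<bar>f (X 1 x)\<bar>)" using f by (simp add: cid_class_def)
  define A where "A i = {x \<in> space M. real (Suc i) < \<bar>f (X (Suc (i + r)) x)\<bar>}" for i
  have [measurable]: "A i \<in> events" for i unfolding A_def by measurable
  \<comment> \<open>The indicator is taken as a function on \<open>E\<close>, so that
    \<open>expectation_X\<close> can move it from \<open>X (Suc (i + r))\<close> to
    \<open>X 1\<close>.\<close>
  define I where "I i y = (if real (Suc i) < \<bar>f y\<bar> then 1 else 0 :: real)" for i y
  have I[measurable]: "I i \<in> borel_measurable E" for i unfolding I_def[abs_def] by measurable
  have iI: "integrable M (\<lambda>x. I i (X 1 x))" for i
    by (rule integrable_const_bound[where B=1]) (auto simp: I_def)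
  have pA: "prob (A i) = expectation (\<lambda>x. I i (X 1 x))" for i
  proof -
    have "prob (A i) = expectation (indicator (A i))" by simp
    also have "\<dots> = expectation (\<lambda>x. I i (X (Suc (i + r)) x))"
      by (rule Bochner_Integration.integral_cong) (auto simp: A_def I_def indicator_def)
    also have "\<dots> = expectation (\<lambda>x. I i (X 1 x))" by (rule expectation_X[OF I])
    finally show ?thesis .
  qed
  have "(\<Sum>i<n. prob (A i)) \<le> expectation (\<lambda>x. \<bar>f (X 1 x)\<bar>)" for n
  proof -
    have "(\<Sum>i<n. prob (A i)) = expectation (\<lambda>x. \<Sum>i<n. I i (X 1 x))"
      unfolding pA using iI by simp
    also have "\<dots> \<le> expectation (\<lambda>x. \<bar>f (X 1 x)\<bar>)"
      unfolding I_def
      by (rule integral_mono)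
         (use iI iabs sum_indicator_less_le[OF abs_ge_zero] in \<open>auto simp: I_def[abs_def]\<close>)
    finally show ?thesis .
  qed
  then have "summable (\<lambda>i. prob (A i))" by (intro summableI_nonneg_bounded) auto
  then have "AE x in M. eventually (\<lambda>i. x \<in> space M - A i) sequentially"
    by (intro borel_cantelli_AE1) (auto simp: emeasure_eq_measure)
  then show ?thesis
    by eventually_elim (auto elim!: eventually_mono simp: A_def trunc_def)
qed

text \<open>The level and the time grow together, so convergence at fixed levels is not enough. Once
  the level passes \<open>N\<close>, its error is dominated by that of level \<open>N\<close>, which
  is small uniformly in time.\<close>

lemma pred_trunc_tendsto_V:
  assumes f: "f \<in> cid_class M E X"
  shows "AE x in M. (\<lambda>i. pred (trunc f (Suc i)) (i + r) x) \<longlonglongrightarrow> V f x"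
proof -
  have "AE x in M. \<forall>N n. \<bar>pred f n x - pred (trunc f N) n x\<bar> \<le> pred (excess f N) n x"
    unfolding AE_all_countable by (intro allI pred_trunc_le f)
  \<comment> \<open>A higher level is written \<open>N + d\<close>, so that monotonicity in the
    level is a countable family of almost sure inequalities.\<close>
  moreover have "AE x in M. \<forall>N d n. pred (excess f (N + d)) n x \<le> pred (excess f N) n x"
    unfolding AE_all_countable
    by (intro allI pred_mono excess_cid_class f) (auto simp: excess_def)
  ultimately show ?thesis using pred_excess_small[OF f] pred_tendsto_V[OF f]
  proof eventually_elim
    case (elim x)
    have "(\<lambda>i. pred f (i + r) x - pred (trunc f (Suc i)) (i + r) x) \<longlonglongrightarrow> 0"
    proof (rule LIMSEQ_I)
      fix e :: real assume "e > 0"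
      then have "e / 2 > 0" by simp
      with elim(3) obtain N where N: "\<And>i. \<bar>pred (excess f N) i x\<bar> \<le> e / 2" by blast
      show "\<exists>n0. \<forall>i\<ge>n0. norm (pred f (i + r) x - pred (trunc f (Suc i)) (i + r) x - 0) < e"
      proof (intro exI[of _ N] allI impI)
        fix i assume "i \<ge> N"
        then obtain d where d: "Suc i = N + d" using le_Suc_ex[of N "Suc i"] by auto
        have "\<bar>pred f (i + r) x - pred (trunc f (Suc i)) (i + r) x\<bar> \<le> pred (excess f (Suc i)) (i + r) x"
          using elim(1) by blast
        moreover have "pred (excess f (Suc i)) (i + r) x \<le> pred (excess f N) (i + r) x"
          using elim(2) unfolding d by blast
        ultimately show "norm (pred f (i + r) x - pred (trunc f (Suc i)) (i + r) x - 0) < e"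
          using N[of "i + r"] \<open>e > 0\<close> by simp
      qed
    qed
    from tendsto_diff[OF LIMSEQ_ignore_initial_segment[OF elim(4), of r] this] show ?case by simp
  qed
qed

section \<open>Averages of products\<close>

text \<open>
  The summands \<open>Y\<^sub>i f(X\<^sub>i\<^sub>+\<^sub>r\<^sub>+\<^sub>1)\<close> are truncated at level \<open>i + 1\<close> and centred by their predictive means, so that
  Kolmogorov's criterion and Kronecker's lemma apply to the orthogonal differences \<open>D\<close>.
\<close>

lemma centred_averages_tendsto_zero:
  assumes f: "f \<in> cid_class M E X"
    and Y: "\<And>i. Y i \<in> borel_measurable (past M E X (i + r))"
    and bound: "\<forall>i. \<forall>x\<in>space M. \<bar>Y i x\<bar> \<le> c"
  shows "AE x in M. (\<lambda>n. (\<Sum>i<n. Y i x * (trunc f (Suc i) (X (Suc (i + r)) x)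
            - pred (trunc f (Suc i)) (i + r) x)) / real n) \<longlonglongrightarrow> 0"
proof -
  note Yb = bound[rule_format]
  have [measurable]: "f \<in> borel_measurable E" and [measurable]: "X 1 \<in> measurable M E"
    using f X_measurable[of 1] by (auto simp: cid_class_def)
  have iabs: "integrable M (\<lambda>x. \<bar>f (X 1 x)\<bar>)" using f by (simp add: cid_class_def)
  have YM[measurable]: "Y i \<in> borel_measurable M" for i
    by (rule measurable_from_subalg[OF subalgebra_past_cid Y])
  define g where "g i = trunc f (Suc i)" for i
  have gE[measurable]: "g i \<in> borel_measurable E" for i unfolding g_def by (rule trunc_measurable) measurable
  have gH: "g i \<in> cid_class M E X" for i unfolding g_def by (rule trunc_cid_class[OF f])
  have gb: "\<forall>y\<in>space E. \<bar>g i y\<bar> \<le> real (Suc i)" for i unfolding g_def using abs_trunc_le by blast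
  define R where "R i x = g i (X (Suc (i + r)) x) - pred (g i) (i + r) x" for i x
  \<comment> \<open>The division by \<open>Suc i\<close> is the weighting of Kronecker's lemma:
    summability of \<open>D\<close> forces the averages of \<open>Y i * R i\<close> to 0.\<close>
  define D where "D i x = Y i x * R i x / real (Suc i)" for i x
  have RM[measurable]: "R i \<in> borel_measurable M" for i unfolding R_def[abs_def] by measurable
  have DM[measurable]: "D i \<in> borel_measurable M" for i unfolding D_def[abs_def] by measurable
  have R: "integrable M (\<lambda>x. (R i x)\<^sup>2)" "expectation (\<lambda>x. (R i x)\<^sup>2) \<le> expectation (\<lambda>x. (g i (X 1 x))\<^sup>2)" for i
    unfolding R_def by (rule predictive_variance_le[OF gE gb])+
  have DR: "(D i x)\<^sup>2 \<le> c\<^sup>2 * ((R i x)\<^sup>2 / (real (Suc i))\<^sup>2)" if "x \<in> space M" for i x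
  proof -
    have "(Y i x)\<^sup>2 \<le> c\<^sup>2" using Yb[OF that, of i] by (auto simp: abs_le_square_iff[symmetric])
    then have "(Y i x)\<^sup>2 * ((R i x)\<^sup>2 / (real (Suc i))\<^sup>2) \<le> c\<^sup>2 * ((R i x)\<^sup>2 / (real (Suc i))\<^sup>2)"
      by (intro mult_right_mono) auto
    then show ?thesis by (simp add: D_def power_mult_distrib power_divide)
  qed
  have Dsq: "integrable M (\<lambda>x. (D i x)\<^sup>2)" for i
  proof (rule Bochner_Integration.integrable_bound)
    show "integrable M (\<lambda>x. c\<^sup>2 * ((R i x)\<^sup>2 / (real (Suc i))\<^sup>2))" using R by simp
    show "AE x in M. norm ((D i x)\<^sup>2) \<le> norm (c\<^sup>2 * ((R i x)\<^sup>2 / (real (Suc i))\<^sup>2))"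
    proof (rule AE_I2)
      fix x assume "x \<in> space M"
      from DR[OF this, of i] show "norm ((D i x)\<^sup>2) \<le> norm (c\<^sup>2 * ((R i x)\<^sup>2 / (real (Suc i))\<^sup>2))"
        by (simp del: of_nat_Suc)
    qed
  qed measurable
  have gsq: "integrable M (\<lambda>x. (g i (X 1 x))\<^sup>2)" for i
  proof (rule integrable_const_bound[where B="(real (Suc i))\<^sup>2"])
    show "AE x in M. norm ((g i (X 1 x))\<^sup>2) \<le> (real (Suc i))\<^sup>2"
    proof (rule AE_I2)
      fix x
      have "\<bar>g i (X 1 x)\<bar> \<le> \<bar>real (Suc i)\<bar>" unfolding g_def using abs_trunc_le[of f "Suc i"] by simp
      then show "norm ((g i (X 1 x))\<^sup>2) \<le> (real (Suc i))\<^sup>2" by (simp only: abs_le_square_iff real_norm_def abs_power2)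
    qed
  qed measurable
  have ED: "expectation (\<lambda>x. (D i x)\<^sup>2) \<le> c\<^sup>2 * (expectation (\<lambda>x. (g i (X 1 x))\<^sup>2) / (real (Suc i))\<^sup>2)" for i
  proof -
    have "expectation (\<lambda>x. (D i x)\<^sup>2) \<le> expectation (\<lambda>x. c\<^sup>2 * ((R i x)\<^sup>2 / (real (Suc i))\<^sup>2))"
      by (rule integral_mono) (use Dsq R DR in auto)
    also have "\<dots> = c\<^sup>2 * (expectation (\<lambda>x. (R i x)\<^sup>2) / (real (Suc i))\<^sup>2)" by simp
    also have "\<dots> \<le> c\<^sup>2 * (expectation (\<lambda>x. (g i (X 1 x))\<^sup>2) / (real (Suc i))\<^sup>2)"
      by (intro mult_left_mono divide_right_mono R) auto
    finally show ?thesis .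
  qed
  \<comment> \<open>Every variance is compared with a second moment at the single variable
    \<open>X 1\<close>, so the sum moves inside one expectation and
    \<open>sum_truncated_squares_le\<close> applies pointwise.\<close>
  have "(\<Sum>i<n. expectation (\<lambda>x. (D i x)\<^sup>2)) \<le> c\<^sup>2 * (2 * expectation (\<lambda>x. \<bar>f (X 1 x)\<bar>))" for n
  proof -
    have "(\<Sum>i<n. expectation (\<lambda>x. (D i x)\<^sup>2))
        \<le> (\<Sum>i<n. c\<^sup>2 * (expectation (\<lambda>x. (g i (X 1 x))\<^sup>2) / (real (Suc i))\<^sup>2))"
      by (rule sum_mono) (rule ED)
    also have "\<dots> = c\<^sup>2 * expectation (\<lambda>x. \<Sum>i<n. (g i (X 1 x))\<^sup>2 / (real (Suc i))\<^sup>2)"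
      using gsq by (simp add: sum_distrib_left del: of_nat_Suc)
    also have "\<dots> \<le> c\<^sup>2 * expectation (\<lambda>x. 2 * \<bar>f (X 1 x)\<bar>)"
    proof (intro mult_left_mono integral_mono)
      fix x
      have "(\<Sum>i<n. (g i (X 1 x))\<^sup>2 / (real (Suc i))\<^sup>2)
          = (\<Sum>i<n. (if \<bar>f (X 1 x)\<bar> \<le> real (Suc i) then \<bar>f (X 1 x)\<bar>\<^sup>2 else 0) / (real (Suc i))\<^sup>2)"
        by (rule sum.cong) (auto simp: g_def trunc_def)
      also have "\<dots> \<le> 2 * \<bar>f (X 1 x)\<bar>" by (rule sum_truncated_squares_le) simp
      finally show "(\<Sum>i<n. (g i (X 1 x))\<^sup>2 / (real (Suc i))\<^sup>2) \<le> 2 * \<bar>f (X 1 x)\<bar>" .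
    qed (use gsq iabs in \<open>auto simp del: of_nat_Suc\<close>)
    finally show ?thesis by simp
  qed
  then have summable: "summable (\<lambda>i. expectation (\<lambda>x. (D i x)\<^sup>2))"
    by (intro summableI_nonneg_bounded) auto
  have "AE x in M. summable (\<lambda>i. D i x)"
  proof (rule orthogonal_series_AE_summable[where F="\<lambda>i. past M E X (i + r)"])
    show "D i \<in> borel_measurable (past M E X (Suc i + r))" for i
    proof -
      have [measurable]: "Y i \<in> borel_measurable (past M E X (Suc i + r))"
        by (rule past_measurable_mono[OF Y]) simp
      have [measurable]: "pred (g i) (i + r) \<in> borel_measurable (past M E X (Suc i + r))"
        by (rule past_measurable_mono[OF pred_measurable_past]) simp
      have [measurable]: "(\<lambda>x. g i (X (Suc (i + r)) x)) \<in> borel_measurable (past M E X (Suc i + r))"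
        by (rule measurable_compose[OF X_measurable_past gE]) simp_all
      show ?thesis unfolding D_def[abs_def] R_def by measurable
    qed
  next
    fix i and Z :: "'a \<Rightarrow> real"
    assume Z: "Z \<in> borel_measurable (past M E X (i + r))" and Zsq: "integrable M (\<lambda>x. (Z x)\<^sup>2)"
    have ZM[measurable]: "Z \<in> borel_measurable M" by (rule measurable_from_subalg[OF subalgebra_past_cid Z])
    \<comment> \<open>The weight \<open>Y i\<close> is known at time \<open>i + r\<close>, so it is
      absorbed into the test variable.\<close>
    have W: "(\<lambda>x. Z x * Y i x) \<in> borel_measurable (past M E X (i + r))"
      by (rule borel_measurable_times[OF Z Y])
    have WM[measurable]: "(\<lambda>x. Z x * Y i x) \<in> borel_measurable M" by measurable
    \<comment> \<open>Integrability of \<open>Z\<close> suffices, because the remaining factors are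
      bounded by \<open>c\<close> and \<open>Suc i\<close>.\<close>
    have "integrable M Z" by (rule square_integrable_imp_integrable[OF ZM Zsq])
    then have iW: "integrable M (\<lambda>x. Z x * (c * real (Suc i)))" by simp
    have YG: "integrable M (\<lambda>x. (Z x * Y i x) * v x)"
      if v: "v \<in> borel_measurable M" "AE x in M. \<bar>v x\<bar> \<le> real (Suc i)" for v
    proof (rule Bochner_Integration.integrable_bound[OF iW])
      show "AE x in M. norm ((Z x * Y i x) * v x) \<le> norm (Z x * (c * real (Suc i)))"
        using v(2) AE_space
      proof eventually_elim
        case (elim x)
        have "\<bar>Y i x\<bar> * \<bar>v x\<bar> \<le> c * real (Suc i)"
          using Yb[OF elim(2), of i] elim(1) by (intro mult_mono) auto
        then have "\<bar>Z x\<bar> * (\<bar>Y i x\<bar> * \<bar>v x\<bar>) \<le> \<bar>Z x\<bar> * \<bar>c * real (Suc i)\<bar>"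
          by (intro mult_left_mono) linarith+
        then show ?case by (simp add: abs_mult mult.assoc del: of_nat_Suc)
      qed
    qed (use v in measurable)
    have 1: "integrable M (\<lambda>x. (Z x * Y i x) * g i (X (Suc (i + r)) x))"
      by (rule YG) (use gb measurable_space[OF X_Suc_measurable] in \<open>auto simp del: of_nat_Suc\<close>)
    have 2: "integrable M (\<lambda>x. (Z x * Y i x) * pred (g i) (i + r) x)"
      by (rule YG) (use abs_pred_le_const[OF gE gb] in auto)
    have "expectation (\<lambda>x. Z x * D i x) = expectation (\<lambda>x. ((Z x * Y i x) * g i (X (Suc (i + r)) x)
        - (Z x * Y i x) * pred (g i) (i + r) x) / real (Suc i))"
      by (rule Bochner_Integration.integral_cong) (auto simp: D_def R_def algebra_simps simp del: of_nat_Suc)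
    also have "\<dots> = (expectation (\<lambda>x. (Z x * Y i x) * g i (X (Suc (i + r)) x))
        - expectation (\<lambda>x. (Z x * Y i x) * pred (g i) (i + r) x)) / real (Suc i)"
      using 1 2 by simp
    also have "\<dots> = 0" using integral_mult_pred[OF gH _ W 1] by simp
    finally show "expectation (\<lambda>x. Z x * D i x) = 0" .
  qed (use subalgebra_past_cid sets_past_mono Dsq summable in auto)
  then show ?thesis
  proof eventually_elim
    case (elim x)
    show ?case using kronecker[OF elim[unfolded D_def]] by (simp add: R_def g_def)
  qed
qed

text \<open>Each summand splits into a centred truncated term, a null error, and
  \<open>Y i * V f\<close>. The first averages to 0 by the strong law above, the second by Cesaro,
  and the third gives \<open>L * V f\<close>.\<close>

lemma averages_AE_tendsto:
  assumes f: "f \<in> cid_class M E X"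
    and Y: "\<And>i. Y i \<in> borel_measurable (past M E X (i + r))"
    and bound: "\<forall>i. \<forall>x\<in>space M. \<bar>Y i x\<bar> \<le> c"
    and L: "AE x in M. (\<lambda>n. (\<Sum>i<n. Y i x) / real n) \<longlonglongrightarrow> L x"
  shows "AE x in M. (\<lambda>n. (\<Sum>i<n. Y i x * f (X (Suc (i + r)) x)) / real n) \<longlonglongrightarrow> L x * V f x"
  using centred_averages_tendsto_zero[OF f Y bound] L AE_eventually_eq_trunc[OF f, of r]
    pred_trunc_tendsto_V[OF f, of r] AE_space
proof eventually_elim
  case (elim x)
  let ?g = "\<lambda>i. trunc f (Suc i) (X (Suc (i + r)) x)"
  let ?p = "\<lambda>i. pred (trunc f (Suc i)) (i + r) x"
  let ?f = "\<lambda>i. f (X (Suc (i + r)) x)"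
  \<comment> \<open>This error combines the truncation of the observation, eventually zero, and the
    distance from the truncated predictive mean to its limit.\<close>
  define a where "a i = Y i x * ((?f i - ?g i) + (?p i - V f x))" for i
  have "(\<lambda>i. (?f i - ?g i) + (?p i - V f x)) \<longlonglongrightarrow> 0 + 0"
  proof (rule tendsto_add)
    show "(\<lambda>i. ?f i - ?g i) \<longlonglongrightarrow> 0"
      by (rule tendsto_eventually) (use elim(3) in \<open>auto elim!: eventually_mono\<close>)
    show "(\<lambda>i. ?p i - V f x) \<longlonglongrightarrow> 0" using elim(4) by (rule LIM_zero)
  qed
  then have t: "(\<lambda>i. \<bar>(?f i - ?g i) + (?p i - V f x)\<bar> * c) \<longlonglongrightarrow> 0"
    by (intro tendsto_mult_left_zero tendsto_rabs_zero) simp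
  have "a \<longlonglongrightarrow> 0"
  proof (rule Lim_null_comparison[OF _ t], rule always_eventually, rule allI)
    fix i
    show "norm (a i) \<le> \<bar>(?f i - ?g i) + (?p i - V f x)\<bar> * c"
      unfolding a_def real_norm_def abs_mult mult.commute[of "\<bar>Y i x\<bar>"]
      by (rule mult_left_mono[OF bound[rule_format, OF elim(5)]]) simp
  qed
  then have "(\<lambda>n. (\<Sum>i<n. a i) / real n) \<longlonglongrightarrow> 0" by (rule cesaro_mean)
  from tendsto_add[OF tendsto_add[OF elim(1) this] tendsto_mult_right[OF elim(2), of "V f x"]]
  have "(\<lambda>n. (\<Sum>i<n. Y i x * (?g i - ?p i)) / real n + (\<Sum>i<n. a i) / real n
      + (\<Sum>i<n. Y i x) / real n * V f x) \<longlonglongrightarrow> L x * V f x" by simp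
  moreover have "(\<Sum>i<n. Y i x * (?g i - ?p i)) / real n + (\<Sum>i<n. a i) / real n
      + (\<Sum>i<n. Y i x) / real n * V f x = (\<Sum>i<n. Y i x * ?f i) / real n" for n
  proof -
    have "(\<Sum>i<n. Y i x * ?f i) = (\<Sum>i<n. Y i x * (?g i - ?p i) + a i + Y i x * V f x)"
      by (rule sum.cong) (auto simp: a_def algebra_simps)
    then show ?thesis by (simp add: sum.distrib add_divide_distrib sum_distrib_right)
  qed
  ultimately show ?case by simp
qed

text \<open>For truncated \<open>f\<close> the averages are bounded, so almost sure convergence
  implies \<open>L^1\<close> convergence. Truncation costs at most \<open>c\<close> times the
  expected excess, uniformly in \<open>n\<close>, in the averages and again in the limit.\<close>

lemma averages_L1_tendsto:
  assumes f: "f \<in> cid_class M E X"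
    and Y: "\<And>i. Y i \<in> borel_measurable (past M E X (i + r))"
    and bound: "\<forall>i. \<forall>x\<in>space M. \<bar>Y i x\<bar> \<le> c"
    and L: "AE x in M. (\<lambda>n. (\<Sum>i<n. Y i x) / real n) \<longlonglongrightarrow> L x"
    and LM[measurable]: "L \<in> borel_measurable M"
  shows "tendsto_L1 M (\<lambda>n x. (\<Sum>i<n. Y i x * f (X (Suc (i + r)) x)) / real n) (\<lambda>x. L x * V f x)"
proof -
  note Yb = bound[rule_format]
  have YM[measurable]: "Y i \<in> borel_measurable M" for i
    by (rule measurable_from_subalg[OF subalgebra_past_cid Y])
  have c0: "c \<ge> 0"
  proof -
    obtain x where "x \<in> space M" using not_empty by blast
    from Yb[OF this, of 0] show ?thesis by linarith
  qed
  \<comment> \<open>The condition \<open>K \<ge> 0\<close> covers \<open>n = 0\<close>, where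
    division by zero gives the average 0.\<close>
  have sum_le: "(\<Sum>i<n. u i) / real n \<le> K" if "\<And>i. u i \<le> K" "K \<ge> 0" for u :: "nat \<Rightarrow> real" and n K
    using sum_bounded_above[of "{..<n}" u K] that by (cases "n = 0") (auto simp: pos_divide_le_eq mult.commute)
  have avg_le: "\<bar>(\<Sum>i<n. u i) / real n\<bar> \<le> (\<Sum>i<n. \<bar>u i\<bar>) / real n" for u :: "nat \<Rightarrow> real" and n
    by (simp add: divide_right_mono)
  have Lb: "AE x in M. \<bar>L x\<bar> \<le> c"
    using L AE_space
  proof eventually_elim
    case (elim x)
    have "\<bar>(\<Sum>i<n. Y i x) / real n\<bar> \<le> c" for n
      using order_trans[OF avg_le sum_le[OF Yb[OF elim(2)] c0]] .
    then show ?case by (intro LIMSEQ_le_const2[OF tendsto_rabs[OF elim(1)]]) auto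
  qed
  have iL: "integrable M (\<lambda>x. L x * U x)" if "integrable M U" for U
  proof (rule Bochner_Integration.integrable_bound[of M "\<lambda>x. c * U x"])
    show "AE x in M. norm (L x * U x) \<le> norm (c * U x)"
      using Lb by eventually_elim (auto simp: abs_mult intro!: mult_right_mono)
  qed (use that in auto)
  have iY: "integrable M (\<lambda>x. Y i x * U x)" if "integrable M U" for U i
  proof (rule Bochner_Integration.integrable_bound[of M "\<lambda>x. c * U x"])
    show "AE x in M. norm (Y i x * U x) \<le> norm (c * U x)"
      using Yb c0 by (intro AE_I2) (auto simp: abs_mult intro!: mult_right_mono)
  qed (use that in auto)
  define S where "S h n x = (\<Sum>i<n. Y i x * h (X (Suc (i + r)) x)) / real n" for h n x
  have iS: "integrable M (S h n)" if "h \<in> cid_class M E X" for h n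
    unfolding S_def[abs_def]
    by (intro integrable_divide Bochner_Integration.integrable_sum iY integrable_X[OF that])
  have iLV: "integrable M (\<lambda>x. L x * V h x)" if "h \<in> cid_class M E X" for h
    by (rule iL[OF V_integrable[OF that]])
  let ?u = "\<lambda>n. expectation (\<lambda>x. \<bar>S f n x - L x * V f x\<bar>)"
  let ?a = "\<lambda>N n. expectation (\<lambda>x. \<bar>S (trunc f N) n x - L x * V (trunc f N) x\<bar>)"
  let ?e = "\<lambda>N. expectation (\<lambda>x. excess f N (X 1 x))"
  have "?u \<longlonglongrightarrow> 0"
  proof (rule tendsto_zero_approx)
    fix N
    let ?g = "trunc f N"
    have gH: "?g \<in> cid_class M E X" by (rule trunc_cid_class[OF f])
    then have gE: "?g \<in> borel_measurable E" by (simp add: cid_class_def)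
    have gb: "\<forall>y\<in>space E. \<bar>?g y\<bar> \<le> real N" using abs_trunc_le by blast
    have "?a N \<longlonglongrightarrow> expectation (\<lambda>x. 0)"
    \<comment> \<open>The dominating constant has one \<open>c * real N\<close> for the average and
      one for its limit.\<close>
    proof (rule integral_dominated_convergence[where w="\<lambda>_. 2 * (c * real N)"])
      show "AE x in M. (\<lambda>n. \<bar>S ?g n x - L x * V ?g x\<bar>) \<longlonglongrightarrow> 0"
        using averages_AE_tendsto[OF gH Y bound L, folded S_def]
        by eventually_elim (intro tendsto_rabs_zero LIM_zero)
      show "AE x in M. norm \<bar>S ?g n x - L x * V ?g x\<bar> \<le> 2 * (c * real N)" for n
        using Lb abs_V_le_const[OF gE gb] AE_space
      proof eventually_elim
        case (elim x)
        have "\<bar>L x * V ?g x\<bar> \<le> c * real N" unfolding abs_mult by (intro mult_mono elim c0 abs_ge_zero)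
        moreover have "\<bar>S ?g n x\<bar> \<le> c * real N" unfolding S_def
        proof (rule order_trans[OF avg_le sum_le])
          show "\<bar>Y i x * ?g (X (Suc (i + r)) x)\<bar> \<le> c * real N" for i
            unfolding abs_mult by (intro mult_mono Yb elim abs_trunc_le c0 abs_ge_zero)
        qed (use c0 in simp)
        ultimately show ?case by simp
      qed
    qed (use iS[OF gH] iLV[OF gH] in auto)
    then show "?a N \<longlonglongrightarrow> 0" by simp
    fix n
    have SS: "S f n x - S ?g n x = (\<Sum>i<n. Y i x * (f (X (Suc (i + r)) x) - ?g (X (Suc (i + r)) x))) / real n" for x
      by (simp add: S_def right_diff_distrib sum_subtractf diff_divide_distrib)
    have iE: "integrable M (\<lambda>x. excess f N (X (Suc m) x))" for m by (rule expectation_excess_X(1)[OF f])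
    have 1: "expectation (\<lambda>x. \<bar>S f n x - S ?g n x\<bar>) \<le> c * ?e N"
    proof -
      have "expectation (\<lambda>x. \<bar>S f n x - S ?g n x\<bar>)
          \<le> expectation (\<lambda>x. (\<Sum>i<n. c * excess f N (X (Suc (i + r)) x)) / real n)"
      proof (rule integral_mono)
        fix x assume x: "x \<in> space M"
        have "\<bar>S f n x - S ?g n x\<bar> \<le> (\<Sum>i<n. \<bar>Y i x * (f (X (Suc (i + r)) x) - ?g (X (Suc (i + r)) x))\<bar>) / real n"
          unfolding SS by (rule avg_le)
        also have "\<dots> \<le> (\<Sum>i<n. c * excess f N (X (Suc (i + r)) x)) / real n"
          unfolding abs_mult abs_tail
          by (intro divide_right_mono sum_mono mult_right_mono Yb[OF x]) (auto simp: excess_def)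
        finally show "\<bar>S f n x - S ?g n x\<bar> \<le> (\<Sum>i<n. c * excess f N (X (Suc (i + r)) x)) / real n" .
      qed (use iS[OF gH] iS[OF f] iE in auto)
      also have "\<dots> = (\<Sum>i<n. c * expectation (\<lambda>x. excess f N (X (Suc (i + r)) x))) / real n"
        using iE by simp
      also have "\<dots> = (\<Sum>i<n. c * ?e N) / real n"
        by (simp only: expectation_excess_X(2)[OF f])
      also have "\<dots> \<le> c * ?e N"
        by (rule sum_le) (use c0 in \<open>auto intro!: mult_nonneg_nonneg integral_nonneg_AE simp: excess_def\<close>)
      finally show ?thesis .
    qed
    have 2: "expectation (\<lambda>x. \<bar>L x * V ?g x - L x * V f x\<bar>) \<le> c * ?e N"
    proof -
      have "expectation (\<lambda>x. \<bar>L x * V ?g x - L x * V f x\<bar>) \<le> expectation (\<lambda>x. c * \<bar>V f x - V ?g x\<bar>)"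
      proof (rule integral_mono_AE)
        show "AE x in M. \<bar>L x * V ?g x - L x * V f x\<bar> \<le> c * \<bar>V f x - V ?g x\<bar>"
          using Lb
        proof eventually_elim
          case (elim x)
          have "\<bar>L x * V ?g x - L x * V f x\<bar> = \<bar>L x\<bar> * \<bar>V f x - V ?g x\<bar>"
            unfolding right_diff_distrib[symmetric] abs_mult by (simp add: abs_minus_commute)
          with elim show ?case by (simp add: mult_right_mono)
        qed
      qed (use iLV[OF gH] iLV[OF f] V_integrable[OF gH] V_integrable[OF f] in auto)
      also have "\<dots> = c * expectation (\<lambda>x. \<bar>V f x - V ?g x\<bar>)" by simp
      also have "\<dots> \<le> c * ?e N" by (rule mult_left_mono[OF V_trunc_L1[OF f] c0])
      finally show ?thesis .
    qed
    \<comment> \<open>The triangle inequality passes through the truncated average and the truncated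
      limit.\<close>
    have "?u n \<le> expectation (\<lambda>x. \<bar>S ?g n x - L x * V ?g x\<bar> + \<bar>S f n x - S ?g n x\<bar> + \<bar>L x * V ?g x - L x * V f x\<bar>)"
      by (rule integral_mono) (use iS[OF gH] iS[OF f] iLV[OF gH] iLV[OF f] in auto)
    also have "\<dots> = ?a N n + expectation (\<lambda>x. \<bar>S f n x - S ?g n x\<bar>) + expectation (\<lambda>x. \<bar>L x * V ?g x - L x * V f x\<bar>)"
      using iS[OF gH] iS[OF f] iLV[OF gH] iLV[OF f] by simp
    finally show "\<bar>?u n\<bar> \<le> ?a N n + 2 * (c * ?e N)" using 1 2 by simp
  next
    show "(\<lambda>N. 2 * (c * ?e N)) \<longlonglongrightarrow> 0"
      by (intro tendsto_mult_right_zero excess_tendsto[OF f])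
  qed
  then show ?thesis using iS[OF f] iLV[OF f] unfolding tendsto_L1_def S_def by blast
qed

section \<open>Products of consecutive observations\<close>

text \<open>The product involves only observations up to time \<open>i + k\<close>, so it can serve
  as the weight \<open>Y i\<close> with shift \<open>r = k\<close>.\<close>

lemma prod_past_bounded:
  assumes f: "\<forall>j\<in>{1..k}. f j \<in> borel_measurable E"
    and b: "\<forall>j\<in>{1..k}. bounded (f j ` space E)"
  shows "(\<lambda>x. \<Prod>j=1..k. f j (X (i + j) x) :: real) \<in> borel_measurable (past M E X (i + k))"
    and "\<exists>c. \<forall>i. \<forall>x\<in>space M. \<bar>\<Prod>j=1..k. f j (X (i + j) x)\<bar> \<le> c"
proof -
  show "(\<lambda>x. \<Prod>j=1..k. f j (X (i + j) x)) \<in> borel_measurable (past M E X (i + k))"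
    by (rule borel_measurable_prod) (rule measurable_compose[OF X_measurable_past f[rule_format]]; simp)
  have "\<forall>j\<in>{1..k}. \<exists>C. \<forall>y\<in>space E. \<bar>f j y\<bar> \<le> C" using b unfolding bounded_iff by auto
  then obtain C where C: "\<And>j y. j \<in> {1..k} \<Longrightarrow> y \<in> space E \<Longrightarrow> \<bar>f j y\<bar> \<le> C j" by metis
  have "\<bar>\<Prod>j=1..k. f j (X (i + j) x)\<bar> \<le> (\<Prod>j=1..k. C j)" if "x \<in> space M" for i x
    unfolding abs_prod
    by (rule prod_mono) (use C measurable_space[OF X_measurable that] in auto)
  then show "\<exists>c. \<forall>i. \<forall>x\<in>space M. \<bar>\<Prod>j=1..k. f j (X (i + j) x)\<bar> \<le> c" by blast
qed

text \<open>Induction on \<open>k\<close>: the first \<open>k\<close> factors form the weight, with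
  limit supplied by the induction hypothesis, and the new factor is evaluated at the next
  observation \<open>X (Suc (i + k))\<close>.\<close>

lemma product_averages_AE_tendsto:
  assumes "\<And>j. j \<in> {1..k} \<Longrightarrow> f j \<in> cid_class M E X"
    and "\<And>j. j \<in> {1..<k} \<Longrightarrow> bounded (f j ` space E)"
  shows "AE x in M. (\<lambda>n. (\<Sum>i<n. \<Prod>j=1..k. f j (X (i + j) x)) / real n) \<longlonglongrightarrow> (\<Prod>j=1..k. V (f j) x)"
  using assms
proof (induction k)
  case 0
  \<comment> \<open>The empty product averages to 1 except at \<open>n = 0\<close>, where the
    quotient is 0.\<close>
  have "(\<lambda>n. (\<Sum>i<n. 1) / real n) \<longlonglongrightarrow> 1" by (rule cesaro_mean) simp
  then show ?case by simp
next
  case (Suc k)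
  have IH: "AE x in M. (\<lambda>n. (\<Sum>i<n. \<Prod>j=1..k. f j (X (i + j) x)) / real n) \<longlonglongrightarrow> (\<Prod>j=1..k. V (f j) x)"
    by (rule Suc.IH) (use Suc.prems in auto)
  have fE: "\<forall>j\<in>{1..k}. f j \<in> borel_measurable E" and fb: "\<forall>j\<in>{1..k}. bounded (f j ` space E)"
    using Suc.prems by (auto simp: cid_class_def)
  obtain c where c: "\<forall>i. \<forall>x\<in>space M. \<bar>\<Prod>j=1..k. f j (X (i + j) x)\<bar> \<le> c"
    using prod_past_bounded(2)[OF fE fb] by blast
  have "AE x in M. (\<lambda>n. (\<Sum>i<n. (\<Prod>j=1..k. f j (X (i + j) x)) * f (Suc k) (X (Suc (i + k)) x)) / real n)
      \<longlonglongrightarrow> (\<Prod>j=1..k. V (f j) x) * V (f (Suc k)) x"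
    by (rule averages_AE_tendsto[OF _ prod_past_bounded(1)[OF fE fb] c IH]) (use Suc.prems in auto)
  then show ?case by simp
qed

text \<open>No induction in \<open>L^1\<close> is required: the first \<open>k - 1\<close> factors
  are bounded, their almost sure limit is already available, and one application of
  \<open>averages_L1_tendsto\<close> adds the last factor.\<close>

lemma product_averages_L1_tendsto:
  assumes k: "k \<ge> 1" and f: "\<And>j. j \<in> {1..k} \<Longrightarrow> f j \<in> cid_class M E X"
    and b: "\<And>j. j \<in> {1..<k} \<Longrightarrow> bounded (f j ` space E)"
  shows "tendsto_L1 M (\<lambda>n x. (\<Sum>i<n. \<Prod>j=1..k. f j (X (i + j) x)) / real n) (\<lambda>x. \<Prod>j=1..k. V (f j) x)"
proof -
  obtain m where m: "k = Suc m" using k by (cases k) auto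
  have fE: "\<forall>j\<in>{1..m}. f j \<in> borel_measurable E" and fb: "\<forall>j\<in>{1..m}. bounded (f j ` space E)"
    using f b m by (auto simp: cid_class_def)
  obtain c where c: "\<forall>i. \<forall>x\<in>space M. \<bar>\<Prod>j=1..m. f j (X (i + j) x)\<bar> \<le> c"
    using prod_past_bounded(2)[OF fE fb] by blast
  have L: "AE x in M. (\<lambda>n. (\<Sum>i<n. \<Prod>j=1..m. f j (X (i + j) x)) / real n) \<longlonglongrightarrow> (\<Prod>j=1..m. V (f j) x)"
    by (rule product_averages_AE_tendsto) (use f b m in auto)
  have "tendsto_L1 M (\<lambda>n x. (\<Sum>i<n. (\<Prod>j=1..m. f j (X (i + j) x)) * f k (X (Suc (i + m)) x)) / real n)
      (\<lambda>x. (\<Prod>j=1..m. V (f j) x) * V (f k) x)"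
    by (rule averages_L1_tendsto[OF _ prod_past_bounded(1)[OF fE fb] c L]) (use f k in auto)
  then show ?thesis by (simp add: m)
qed

text \<open>Transfers both convergences from the concrete \<open>V\<close> to the chosen versions,
  which differ from it only on finitely many null sets.\<close>

lemma product_averages_tendsto_cid_limit:
  assumes k: "k \<ge> 1" and f: "\<And>j. j \<in> {1..k} \<Longrightarrow> f j \<in> cid_class M E X"
    and b: "\<And>j. j \<in> {1..<k} \<Longrightarrow> bounded (f j ` space E)"
  shows "tendsto_AE M (\<lambda>n x. (1 / real n) * (\<Sum>i<n. \<Prod>j=1..k. f j (X (i + j) x)))
      (\<lambda>x. \<Prod>j=1..k. cid_limit M X (f j) x)"
    and "tendsto_L1 M (\<lambda>n x. (1 / real n) * (\<Sum>i<n. \<Prod>j=1..k. f j (X (i + j) x)))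
      (\<lambda>x. \<Prod>j=1..k. cid_limit M X (f j) x)"
proof -
  have "AE x in M. \<forall>j\<in>{1..k}. V (f j) x = cid_limit M X (f j) x"
    by (rule AE_finite_allI) (use f cid_limit_AE_eq_V in auto)
  then have eq: "AE x in M. (\<Prod>j=1..k. V (f j) x) = (\<Prod>j=1..k. cid_limit M X (f j) x)"
    by eventually_elim simp
  have "AE x in M. (\<lambda>n. (\<Sum>i<n. \<Prod>j=1..k. f j (X (i + j) x)) / real n) \<longlonglongrightarrow> (\<Prod>j=1..k. V (f j) x)"
    by (rule product_averages_AE_tendsto) (use f b in auto)
  with eq show "tendsto_AE M (\<lambda>n x. (1 / real n) * (\<Sum>i<n. \<Prod>j=1..k. f j (X (i + j) x)))
      (\<lambda>x. \<Prod>j=1..k. cid_limit M X (f j) x)"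
    unfolding tendsto_AE_def by eventually_elim simp
  let ?S = "\<lambda>n x. (\<Sum>i<n. \<Prod>j=1..k. f j (X (i + j) x)) / real n"
  have L1: "tendsto_L1 M ?S (\<lambda>x. \<Prod>j=1..k. V (f j) x)"
    by (rule product_averages_L1_tendsto[OF k f b])
  have [measurable]: "cid_limit M X (f j) \<in> borel_measurable M" if "j \<in> {1..k}" for j
    using cid_limit_integrable[OF f[OF that]] by simp
  have M: "(\<lambda>x. \<Prod>j=1..k. cid_limit M X (f j) x) \<in> borel_measurable M"
    by (rule borel_measurable_prod) measurable
  have iS: "integrable M (?S n)" for n using L1 by (simp add: tendsto_L1_def)
  have iV: "integrable M (\<lambda>x. \<Prod>j=1..k. V (f j) x)" using L1 by (simp add: tendsto_L1_def)
  \<comment> \<open>A product of integrable variables may fail to be integrable, so integrability is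
    inherited from the almost surely equal product of the \<open>V (f j)\<close>.\<close>
  have iL: "integrable M (\<lambda>x. \<Prod>j=1..k. cid_limit M X (f j) x)"
    using iV by (rule integrable_cong_AE_imp[OF _ M]) (use eq in \<open>auto elim!: eventually_mono\<close>)
  have "expectation (\<lambda>x. \<bar>?S n x - (\<Prod>j=1..k. cid_limit M X (f j) x)\<bar>)
      = expectation (\<lambda>x. \<bar>?S n x - (\<Prod>j=1..k. V (f j) x)\<bar>)" for n
    by (rule integral_cong_AE)
       (use eq borel_measurable_integrable[OF iS[of n]] M in \<open>auto elim!: eventually_mono\<close>)
  then have "tendsto_L1 M ?S (\<lambda>x. \<Prod>j=1..k. cid_limit M X (f j) x)"
    using L1 iL unfolding tendsto_L1_def by simp
  then show "tendsto_L1 M (\<lambda>n x. (1 / real n) * (\<Sum>i<n. \<Prod>j=1..k. f j (X (i + j) x)))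
      (\<lambda>x. \<Prod>j=1..k. cid_limit M X (f j) x)" by simp
qed

text \<open>This is the case \<open>k = 1\<close>, after reindexing the sum over \<open>1..n\<close>
  to start at 0.\<close>

lemma averages_tendsto_cid_limit:
  assumes g: "g \<in> cid_class M E X"
  shows "tendsto_AE M (\<lambda>n x. (1 / real n) * (\<Sum>i=1..n. g (X i x))) (cid_limit M X g)"
    and "tendsto_L1 M (\<lambda>n x. (1 / real n) * (\<Sum>i=1..n. g (X i x))) (cid_limit M X g)"
proof -
  have "(\<Sum>i=1..n. g (X i x)) = (\<Sum>i<n. g (X (Suc i) x))" for n x
    by (simp add: sum.atLeast1_atMost_eq)
  then show "tendsto_AE M (\<lambda>n x. (1 / real n) * (\<Sum>i=1..n. g (X i x))) (cid_limit M X g)"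
    "tendsto_L1 M (\<lambda>n x. (1 / real n) * (\<Sum>i=1..n. g (X i x))) (cid_limit M X g)"
    using product_averages_tendsto_cid_limit[of 1 "\<lambda>_. g"] g by simp_all
qed

end

theorem theorem2p2:
  fixes M :: "'a measure" and E :: "'b measure"
    and X :: "nat \<Rightarrow> 'a \<Rightarrow> 'b"
    and k :: nat and f :: "nat \<Rightarrow> 'b \<Rightarrow> real"
  assumes "prob_space M"
    and "cid M E X"
    and "k \<ge> 1"
    and "\<And>j. j \<in> {1..k} \<Longrightarrow> f j \<in> cid_class M E X"
    and "\<And>j. j \<in> {1..<k} \<Longrightarrow> bounded (f j ` space E)"
  shows
    "tendsto_AE M (\<lambda>n \<omega>. (1 / real n) * (\<Sum>i<n. \<Prod>j=1..k. f j (X (i + j) \<omega>)))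
                  (\<lambda>\<omega>. \<Prod>j=1..k. cid_limit M X (f j) \<omega>)
     \<and> tendsto_L1 M (\<lambda>n \<omega>. (1 / real n) * (\<Sum>i<n. \<Prod>j=1..k. f j (X (i + j) \<omega>)))
                  (\<lambda>\<omega>. \<Prod>j=1..k. cid_limit M X (f j) \<omega>)
     \<and> (\<forall>g \<in> cid_class M E X.
          tendsto_AE M (\<lambda>n \<omega>. (1 / real n) * (\<Sum>i=1..n. g (X i \<omega>))) (cid_limit M X g)
        \<and> tendsto_L1 M (\<lambda>n \<omega>. (1 / real n) * (\<Sum>i=1..n. g (X i \<omega>))) (cid_limit M X g))"
proof -
  interpret prob_space M by fact
  interpret cid_process M E X by unfold_locales fact
  show ?thesis
    by (intro conjI ballI product_averages_tendsto_cid_limit averages_tendsto_cid_limit) (use assms in auto)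
qed

end
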